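(* (i) Let $f$ be a probability density function on $\mathbb{T}$ and let $\{\ell_n\}_{n\in\mathbb{N}}$ be a decreasing sequence of positive numbers with $0<\ell_n<1$. Assume $m_f>0$, $\dim_{\mathrm H}K_f<1$, and $$\dim_{\mathrm H}K_f<\liminf_{n\to\infty}m_f\,n\,\ell_n\le\limsup_{n\to\infty}m_f\,n\,\ell_n<\infty .$$ Then the circle is $\mu_f$-Dvoretzky covered for $\{\ell_n\}$ if and only if $$(\ast)\qquad\limsup_{n\to\infty}\left(\frac{\ell_1+\dots+\ell_n}{\ln n}\right)\ge\frac1{m_f}.$$ (ii) However, for every $\beta>1$ there exists a probability density function $f$ on $\mathbb{T}$ with $m_f>0$ and $\dim_{\mathrm H}K_f=1$ such that, for a decreasing sequence $\{\ell_n\}$ with $0<\ell_n<1$ given by $$\ell_n=\frac1{m_f}\left(\frac1n-\frac{1+\beta}{n\ln n}\right)\quad\text{for all sufficiently large } n,$$ condition $(\ast)$ is fulfilled but $\mathbb{T}$ is not $\mu_f$-Dvoretzky covered for $\{\ell_n\}$.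
   Context: $\mathbb{T}=\mathbb{R}/\mathbb{Z}$ is the circle with its usual metric and Lebesgue measure $|\cdot|$ (total mass $1$). A probability density function is a nonnegative $f\in L^1(\mathbb{T})$ with $\int_{\mathbb{T}}f=1$, and $\mu_f$ is the probability measure with $d\mu_f=f\,dx$. Given $\{\ell_n\}$, let $\{\omega_n\}$ be i.i.d. random variables on $\mathbb{T}$ with distribution $\mu_f$ and $I_n=(\omega_n-\ell_n/2,\ \omega_n+\ell_n/2)\subset\mathbb{T}$. The circle is $\mu_f$-Dvoretzky covered for $\{\ell_n\}$ if almost surely $\mathbb{T}=\limsup_{n\to\infty}I_n$, i.e. almost surely every point of $\mathbb{T}$ lies in infinitely many $I_n$. For a measurable set $J\subset\mathbb{T}$ with $|J|>0$, $\mathrm{ess\,inf}_J f=\sup\{a\in\mathbb{R}: f(x)\ge a \text{ for Lebesgue a.e. } x\in J\}$. Put $m_f=\mathrm{ess\,inf}_{\mathbb{T}}f$ and $K_f=\{x\in\mathbb{T}:\lim_{n\to\infty}\mathrm{ess\,inf}_{B(x,1/n)}f=m_f\}$, where $B(x,r)$ is the ball of radius $r$ centered at $x$. $\dim_{\mathrm H}$ is Hausdorff dimension. *)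

theory Defs
  imports "HOL-Probability.Probability"
begin

section \<open>The circle $\mathbb{R}/\mathbb{Z}$\<close>

quotient_type circle = real / "\<lambda>s t :: real. s - t \<in> \<int>"
  morphisms rep_circle to_circle
proof (rule equivpI)
  show "reflp (\<lambda>s t :: real. s - t \<in> \<int>)"
    by (auto intro: reflpI)
  show "symp (\<lambda>s t :: real. s - t \<in> \<int>)"
    by (metis (mono_tags, lifting) Ints_minus minus_diff_eq sympI)
  show "transp (\<lambda>s t :: real. s - t \<in> \<int>)"
  proof (rule transpI)
    fix s t u :: real
    assume "s - t \<in> \<int>" "t - u \<in> \<int>"
    then have "(s - t) + (t - u) \<in> \<int>" by (rule Ints_add)
    then show "s - u \<in> \<int>" by simp
  qed
qed

lemma round_dist_le_abs: "\<bar>z - of_int (round z)\<bar> \<le> \<bar>z\<bar>" for z :: real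
  using round_diff_minimal[of z 0] by simp

instantiation circle :: metric_space
begin

text \<open>The distance of two points is the distance of \<open>s - t\<close> to the nearest integer.\<close>

lift_definition dist_circle :: "circle \<Rightarrow> circle \<Rightarrow> real"
  is "\<lambda>s t. \<bar>(s - t) - of_int (round (s - t))\<bar>"
proof -
  fix s s' t t' :: real
  assume "s - s' \<in> \<int>" "t - t' \<in> \<int>"
  then have "(s - s') - (t - t') \<in> \<int>" by (rule Ints_diff)
  then obtain k :: int where "(s - s') - (t - t') = of_int k" by (auto elim: Ints_cases)
  then have k: "s - t = (s' - t') + of_int k" by simp
  have "round (s - t) = round (s' - t') + k"
  proof -
    have "(s' - t') + of_int k + 1 / 2 = (s' - t' + 1 / 2) + of_int k" by simp
    then show ?thesis unfolding k round_def by (simp only: floor_add_int)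
  qed
  then show "\<bar>(s - t) - of_int (round (s - t))\<bar> = \<bar>(s' - t') - of_int (round (s' - t'))\<bar>"
    using k by simp
qed

definition uniformity_circle :: "(circle \<times> circle) filter"
  where "uniformity_circle = (INF e\<in>{0<..}. principal {(x, y). dist x y < e})"

definition open_circle :: "circle set \<Rightarrow> bool"
  where "open_circle U \<longleftrightarrow> (\<forall>x\<in>U. \<forall>\<^sub>F (x', y) in uniformity. x' = x \<longrightarrow> y \<in> U)"

instance
proof
  fix x y z :: circle
  show "dist x y = 0 \<longleftrightarrow> x = y"
  proof (transfer, intro iffI)
    fix s t :: real
    assume "\<bar>(s - t) - of_int (round (s - t))\<bar> = 0"
    then have "s - t = of_int (round (s - t))" by simp
    then show "s - t \<in> \<int>" by (metis Ints_of_int)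
  next
    fix s t :: real
    assume "s - t \<in> \<int>"
    then show "\<bar>(s - t) - of_int (round (s - t))\<bar> = 0" by (auto elim!: Ints_cases)
  qed
  show "dist x y \<le> dist x z + dist y z"
  proof transfer
    fix s t u :: real
    let ?m = "round (s - u)" and ?n = "round (t - u)"
    have "\<bar>(s - t) - of_int (round (s - t))\<bar> \<le> \<bar>(s - t) - of_int (?m - ?n)\<bar>"
      by (rule round_diff_minimal)
    also have "\<dots> \<le> \<bar>(s - u) - of_int ?m\<bar> + \<bar>(t - u) - of_int ?n\<bar>" by simp
    finally show "\<bar>(s - t) - of_int (round (s - t))\<bar>
        \<le> \<bar>(s - u) - of_int ?m\<bar> + \<bar>(t - u) - of_int ?n\<bar>" .
  qed
qed (simp_all add: uniformity_circle_def open_circle_def)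

end

lemma to_circle_eq_iff: "to_circle s = to_circle t \<longleftrightarrow> s - t \<in> \<int>"
  by (rule circle.abs_eq_iff)

lemma dist_to_circle: "dist (to_circle s) (to_circle t) = \<bar>(s - t) - of_int (round (s - t))\<bar>"
  by (rule dist_circle.abs_eq)

lemma dist_to_circle_le: "dist (to_circle s) (to_circle t) \<le> dist s t"
  unfolding dist_to_circle dist_real_def by (rule round_dist_le_abs)

lemma continuous_on_to_circle: "continuous_on A to_circle"
  unfolding continuous_on_iff using dist_to_circle_le le_less_trans by blast

lemma measurable_to_circle [measurable]: "to_circle \<in> borel_measurable borel"
  by (rule borel_measurable_continuous_onI[OF continuous_on_to_circle])

lemma to_circle_rep: "to_circle (rep_circle x) = x"
  by (rule Quotient3_abs_rep[OF Quotient3_circle])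

lemma to_circle_frac: "to_circle (frac t) = to_circle t"
  by (simp add: to_circle_eq_iff frac_def)

lemma surj_to_circle: "to_circle ` {0..1} = UNIV"
proof -
  have "x \<in> to_circle ` {0..1}" for x
  proof -
    have "x = to_circle (frac (rep_circle x))" by (simp add: to_circle_frac to_circle_rep)
    then show ?thesis
      by (rule image_eqI) (simp add: less_imp_le[OF frac_lt_1])
  qed
  then show ?thesis by auto
qed

lemma compact_UNIV_circle: "compact (UNIV :: circle set)"
  unfolding surj_to_circle[symmetric]
  by (rule compact_continuous_image[OF continuous_on_to_circle compact_Icc])

definition circle_lebesgue :: "circle measure"
  where "circle_lebesgue = distr (restrict_space lborel {0..<1}) borel to_circle"

lemma sets_circle_lebesgue [simp, measurable_cong]: "sets circle_lebesgue = sets borel"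
  by (simp add: circle_lebesgue_def)

lemma space_circle_lebesgue [simp]: "space circle_lebesgue = UNIV"
  by (simp add: circle_lebesgue_def)

lemma prob_space_circle_lebesgue: "prob_space circle_lebesgue"
proof -
  interpret prob_space "restrict_space lborel {0..<1::real}"
    by (rule prob_spaceI) (simp add: emeasure_restrict_space)
  have "to_circle \<in> measurable (restrict_space lborel {0..<1}) borel"
    by (rule measurable_restrict_space1) simp
  then show ?thesis
    unfolding circle_lebesgue_def by (rule prob_space_distr)
qed

text \<open>The open arc with centre \<open>c\<close> and length \<open>l\<close>, i.e. the projection of an open interval.\<close>

definition arc_at :: "circle \<Rightarrow> real \<Rightarrow> circle set"
  where "arc_at c l = to_circle ` {rep_circle c - l / 2 <..< rep_circle c + l / 2}"

lemma arc_at_eq_ball: "arc_at c l = ball c (l / 2)"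
proof (intro set_eqI iffI)
  fix x
  assume "x \<in> arc_at c l"
  then obtain t where "x = to_circle t" "rep_circle c - l / 2 < t" "t < rep_circle c + l / 2"
    unfolding arc_at_def by auto
  then have t: "x = to_circle t" "\<bar>rep_circle c - t\<bar> < l / 2"
    by (simp_all only: abs_less_iff) linarith
  have "dist (to_circle (rep_circle c)) x \<le> \<bar>rep_circle c - t\<bar>"
    using dist_to_circle_le[of "rep_circle c" t] t by (simp add: dist_real_def)
  with t show "x \<in> ball c (l / 2)" by (simp add: to_circle_rep)
next
  fix x
  assume x: "x \<in> ball c (l / 2)"
  define s where "s = rep_circle c"
  define t where "t = rep_circle x + of_int (round (s - rep_circle x))"
  have "to_circle t = to_circle (rep_circle x)" by (simp add: t_def to_circle_eq_iff)
  then have "x = to_circle t" by (simp add: to_circle_rep)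
  have "\<bar>s - t\<bar> < l / 2"
    using x dist_to_circle[of s "rep_circle x"]
    by (simp add: s_def t_def to_circle_rep algebra_simps)
  then have "t \<in> {s - l / 2 <..< s + l / 2}"
    unfolding abs_less_iff greaterThanLessThan_iff by linarith
  with \<open>x = to_circle t\<close> show "x \<in> arc_at c l"
    unfolding arc_at_def s_def[symmetric] by blast
qed

section \<open>Hausdorff dimension\<close>

definition hausdorff_premeasure :: "real \<Rightarrow> real \<Rightarrow> 'a::metric_space set \<Rightarrow> ennreal"
  where "hausdorff_premeasure s \<delta> A =
    (INF U \<in> {U :: nat \<Rightarrow> 'a set. A \<subseteq> (\<Union>n. U n) \<and> (\<forall>n. bounded (U n) \<and> diameter (U n) \<le> \<delta>)}.
      (\<Sum>n. ennreal (diameter (U n) powr s)))"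

definition hausdorff_measure :: "real \<Rightarrow> 'a::metric_space set \<Rightarrow> ennreal"
  where "hausdorff_measure s A = (SUP \<delta> \<in> {0<..}. hausdorff_premeasure s \<delta> A)"

text \<open>
  Only exponents \<open>s > 0\<close> are used: this does not change the infimum, and it avoids
  \<open>0 powr 0 = 0\<close>, which would give the wrong measure for \<open>s = 0\<close>.
\<close>

definition hausdorff_dim :: "'a::metric_space set \<Rightarrow> ereal"
  where "hausdorff_dim A = (INF s \<in> {s. 0 < s \<and> hausdorff_measure s A = 0}. ereal s)"

section \<open>Densities and essential infima\<close>

definition prob_density :: "(circle \<Rightarrow> real) \<Rightarrow> bool"
  where "prob_density f \<longleftrightarrow> integrable circle_lebesgue f
    \<and> (AE x in circle_lebesgue. 0 \<le> f x) \<and> (\<integral>x. f x \<partial>circle_lebesgue) = 1"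

definition density_measure :: "(circle \<Rightarrow> real) \<Rightarrow> circle measure"
  where "density_measure f = density circle_lebesgue (\<lambda>x. ennreal (f x))"

lemma prob_space_density_measure:
  assumes "prob_density f"
  shows "prob_space (density_measure f)"
proof (rule prob_spaceI)
  have [measurable]: "f \<in> borel_measurable circle_lebesgue"
    using assms by (auto simp: prob_density_def)
  have "emeasure (density_measure f) (space (density_measure f))
      = (\<integral>\<^sup>+x. ennreal (f x) \<partial>circle_lebesgue)"
    unfolding density_measure_def by (subst emeasure_density) (auto intro!: nn_integral_cong)
  also have "\<dots> = 1"
    using assms by (subst nn_integral_eq_integral) (auto simp: prob_density_def)
  finally show "emeasure (density_measure f) (space (density_measure f)) = 1" .
qed

definition ess_inf :: "circle set \<Rightarrow> (circle \<Rightarrow> real) \<Rightarrow> real"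
  where "ess_inf J f = Sup {a. AE x in circle_lebesgue. x \<in> J \<longrightarrow> f x \<ge> a}"

abbreviation ess_min :: "(circle \<Rightarrow> real) \<Rightarrow> real"
  where "ess_min f \<equiv> ess_inf UNIV f"

definition ess_min_set :: "(circle \<Rightarrow> real) \<Rightarrow> circle set"
  where "ess_min_set f = {x. (\<lambda>n. ess_inf (ball x (1 / real n)) f) \<longlonglongrightarrow> ess_min f}"

section \<open>Dvoretzky covering\<close>

text \<open>
  Sequences are indexed by \<open>n \<ge> 1\<close>; the value at \<open>0\<close> is irrelevant.
\<close>

definition arc_lengths :: "(nat \<Rightarrow> real) \<Rightarrow> bool"
  where "arc_lengths l \<longleftrightarrow> antimono_on {1..} l \<and> (\<forall>n\<ge>1. 0 < l n \<and> l n < 1)"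

definition covers_circle :: "(nat \<Rightarrow> real) \<Rightarrow> (nat \<Rightarrow> circle) \<Rightarrow> bool"
  where "covers_circle l \<omega> \<longleftrightarrow> (\<forall>x. infinite {n. n \<ge> 1 \<and> x \<in> arc_at (\<omega> n) (l n)})"

text \<open>
  The i.i.d. sequence is realised as the coordinate process of the infinite product measure;
  \<open>dvoretzky_covered_iff\<close> below shows that any other realisation gives the same notion.
\<close>

definition dvoretzky_covered :: "(circle \<Rightarrow> real) \<Rightarrow> (nat \<Rightarrow> real) \<Rightarrow> bool"
  where "dvoretzky_covered f l \<longleftrightarrow>
    (AE \<omega> in (\<Pi>\<^sub>M n\<in>UNIV. density_measure f). covers_circle l \<omega>)"

lemma covers_circle_iff:
  "covers_circle l \<omega> \<longleftrightarrow> (\<forall>N\<ge>1. \<exists>k. \<forall>q\<in>\<rat>. \<exists>n\<ge>N.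
     dist (to_circle q) (\<omega> n) < l n / 2 - 1 / real (Suc k))" (is "_ \<longleftrightarrow> ?R")
proof
  assume cov: "covers_circle l \<omega>"
  show ?R
  proof (intro allI impI)
    fix N :: nat
    assume N: "N \<ge> 1"
    let ?B = "\<lambda>(n, k). ball (\<omega> n) (l n / 2 - 1 / real (Suc k))"
    have "UNIV \<subseteq> (\<Union>p\<in>{N..} \<times> UNIV. ?B p)"
    proof
      fix x
      have "infinite {n. n \<ge> 1 \<and> x \<in> arc_at (\<omega> n) (l n)}"
        using cov by (simp add: covers_circle_def)
      then obtain n where n: "n \<ge> N" "x \<in> arc_at (\<omega> n) (l n)"
        unfolding infinite_nat_iff_unbounded_le by blast
      then have "0 < l n / 2 - dist (\<omega> n) x" by (simp add: arc_at_eq_ball)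
      then obtain k where "1 / real (Suc k) < l n / 2 - dist (\<omega> n) x"
        using nat_approx_posE by blast
      then have "x \<in> ?B (n, k)" by simp
      with n show "x \<in> (\<Union>p\<in>{N..} \<times> UNIV. ?B p)" by blast
    qed
    then obtain F where F: "F \<subseteq> {N..} \<times> UNIV" "finite F" "UNIV \<subseteq> (\<Union>p\<in>F. ?B p)"
      by (rule compactE_image[OF compact_UNIV_circle, rotated]) auto
    define K where "K = Max (insert 0 (snd ` F))"
    have "\<exists>n\<ge>N. dist x (\<omega> n) < l n / 2 - 1 / real (Suc K)" for x
    proof -
      from F(3) obtain n k where nk: "(n, k) \<in> F" "x \<in> ball (\<omega> n) (l n / 2 - 1 / real (Suc k))"
        by fast
      have "k \<le> K" unfolding K_def using nk(1) F(2) by (force intro!: Max_ge)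
      then have "1 / real (Suc K) \<le> 1 / real (Suc k)" by (simp add: frac_le)
      with nk(2) have "dist x (\<omega> n) < l n / 2 - 1 / real (Suc K)"
        by (simp add: dist_commute)
      moreover have "n \<ge> N" using nk(1) F(1) by auto
      ultimately show ?thesis by blast
    qed
    then show "\<exists>k. \<forall>q\<in>\<rat>. \<exists>n\<ge>N. dist (to_circle q) (\<omega> n) < l n / 2 - 1 / real (Suc k)"
      by blast
  qed
next
  assume R: ?R
  have "\<exists>n\<ge>N. n \<ge> 1 \<and> x \<in> arc_at (\<omega> n) (l n)" for N x
  proof -
    obtain k where k: "\<forall>q\<in>\<rat>. \<exists>n\<ge>Suc N.
        dist (to_circle q) (\<omega> n) < l n / 2 - 1 / real (Suc k)"
      using R by (metis One_nat_def Suc_le_mono le0)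
    obtain q where q: "q \<in> \<rat>" "rep_circle x < q" "q < rep_circle x + 1 / real (Suc k)"
      using Rats_dense_in_real[of "rep_circle x" "rep_circle x + 1 / real (Suc k)"] by auto
    have "dist (to_circle q) (to_circle (rep_circle x)) \<le> dist q (rep_circle x)"
      by (rule dist_to_circle_le)
    with q have "dist (to_circle q) x < 1 / real (Suc k)"
      by (simp add: to_circle_rep dist_real_def)
    moreover obtain n where n: "n \<ge> Suc N"
        "dist (to_circle q) (\<omega> n) < l n / 2 - 1 / real (Suc k)"
      using k q(1) by blast
    moreover have "dist (\<omega> n) x \<le> dist (to_circle q) (\<omega> n) + dist (to_circle q) x"
      by (metis dist_commute dist_triangle)
    ultimately have "dist (\<omega> n) x < l n / 2" by linarith
    with n(1) show ?thesis by (auto simp: arc_at_eq_ball intro!: exI[of _ n])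
  qed
  then show "covers_circle l \<omega>"
    unfolding covers_circle_def infinite_nat_iff_unbounded_le by simp
qed

lemma dvoretzky_covered_iff:
  fixes M :: "'a measure" and X :: "nat \<Rightarrow> 'a \<Rightarrow> circle"
  assumes "prob_space M" and "prob_space.indep_vars M (\<lambda>_. borel) X UNIV"
    and "\<And>n. distr M borel (X n) = density_measure f"
  shows "dvoretzky_covered f l \<longleftrightarrow> (AE w in M. covers_circle l (\<lambda>n. X n w))"
proof -
  interpret prob_space M by fact
  let ?P = "\<Pi>\<^sub>M n\<in>(UNIV :: nat set). (borel :: circle measure)"
  have X [measurable]: "X n \<in> borel_measurable M" for n
    using assms(2) by (auto simp: indep_vars_def)
  have "distr M ?P (\<lambda>w. \<lambda>n\<in>UNIV. X n w) = (\<Pi>\<^sub>M n\<in>UNIV. distr M borel (X n))"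
    using indep_vars_iff_distr_eq_PiM[of UNIV X "\<lambda>_. borel"] assms(2) X by simp
  then have eq: "(\<Pi>\<^sub>M n\<in>UNIV. density_measure f) = distr M ?P (\<lambda>w n. X n w)"
    by (simp add: assms(3) restrict_def)
  have pred: "Measurable.pred ?P (\<lambda>\<omega>. covers_circle l \<omega>)"
  proof -
    have [measurable]: "Measurable.pred ?P (\<lambda>\<omega>. dist x (\<omega> n) < r)" for x :: circle and n r
    proof -
      have [measurable]: "(\<lambda>\<omega>. \<omega> n) \<in> measurable ?P borel"
        by (rule measurable_component_singleton) simp
      have [measurable]: "Measurable.pred borel (\<lambda>y. dist x y < r)"
        using borel_open[OF open_ball[of x r]] by (simp add: pred_def ball_def)
      show ?thesis by measurable
    qed
    have "Measurable.pred ?P (\<lambda>\<omega>. \<forall>N\<ge>1. \<exists>k. \<forall>q\<in>\<rat>. \<exists>n\<ge>N.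
        dist (to_circle q) (\<omega> n) < l n / 2 - 1 / real (Suc k))"
      using countable_rat by measurable
    then show ?thesis by (simp only: covers_circle_iff)
  qed
  have "(\<lambda>w n. X n w) \<in> measurable M ?P"
    by (rule measurable_PiM_single') (auto simp: space_PiM)
  moreover have "{\<omega> \<in> space ?P. covers_circle l \<omega>} \<in> sets ?P"
    using pred by (simp add: pred_def)
  ultimately show ?thesis
    unfolding dvoretzky_covered_def eq by (rule AE_distr_iff)
qed

end

theory Submission
  imports Defs "HOL-Real_Asymp.Real_Asymp"
begin

text \<open>
  Let \<open>m = ess_min f\<close> and \<open>S\<^sub>n = l\<^sub>1 + \<dots> + l\<^sub>n\<close>.

  Covering is a first moment argument. An arc of radius \<open>d\<close> is missed by the first \<open>n\<close> intervals
  with probability about \<open>exp (- a S\<^sub>n)\<close>, where \<open>a\<close> is a lower bound of \<open>f\<close> near the arc, as long as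
  \<open>n d\<close> stays bounded. Near a point outside \<open>ess_min_set f\<close> one may take \<open>a > m\<close>; along the indices
  for which \<open>S\<^sub>n\<close> is close to \<open>ln n / m\<close>, the \<open>n\<close> arcs of radius \<open>1 / n\<close> then have total miss
  probability \<open>n exp (- a S\<^sub>n) \<longlonglongrightarrow> 0\<close>. On \<open>ess_min_set f\<close> itself \<open>a = m\<close>; since \<open>m n l\<^sub>n > s\<close> for some
  \<open>s\<close> at which the Hausdorff measure vanishes, a set of diameter \<open>d\<close> is missed with probability
  \<open>O (d powr s)\<close>, which is summed over an economical cover.

  Failure of covering is a second moment argument: if \<open>\<mu>\<^sub>f (ball x (l\<^sub>n / 2)) \<le> c l\<^sub>n\<close> on a set of
  positive measure and \<open>exp (c S\<^sub>n) / n\<^sup>2\<close> is summable, then the uncovered part of that set survives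
  with positive probability. When the sum condition fails, Vitali's covering theorem provides such
  a set for every \<open>c > m\<close>. For the counterexample take \<open>f = 1\<close>: then \<open>ess_min_set f\<close> is the whole
  circle, and Shepp's series \<open>exp (S\<^sub>n) / n\<^sup>2\<close>, of order \<open>1 / (n (ln n) powr (1 + \<beta>))\<close>, converges.
\<close>

section \<open>Lebesgue measure of balls in the circle\<close>

lemma emeasure_lborel_shift:
  assumes "S \<in> sets borel"
  shows "emeasure lborel {x. c + x \<in> S} = emeasure lborel (S :: real set)"
proof -
  have "emeasure lborel S = emeasure (distr lborel borel ((+) c)) S"
    by (simp add: lborel_distr_plus)
  also have "\<dots> = emeasure lborel ((+) c -` S \<inter> space lborel)"
    using assms by (subst emeasure_distr) auto
  finally show ?thesis by (simp add: vimage_def)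
qed

lemma to_circle_add_int: "to_circle (of_int k + t) = to_circle t"
  by (simp add: to_circle_eq_iff)

lemma sets_vimage_to_circle [measurable]:
  assumes "A \<in> sets borel"
  shows "to_circle -` A \<in> sets borel"
  using measurable_sets[OF measurable_to_circle assms] by simp

text \<open>Every half-open interval of length 1 is a fundamental domain. With
  \<open>k = \<lfloor>a\<rfloor>\<close>, the interval \<open>{0..<1}\<close> is cut at
  \<open>a - k\<close>; the upper piece is translated by \<open>k\<close>, the lower one by
  \<open>k + 1\<close>.\<close>

lemma emeasure_circle_lebesgue:
  assumes A [measurable]: "A \<in> sets borel"
  shows "emeasure circle_lebesgue A = emeasure lborel ({a..<a+1} \<inter> to_circle -` A)"
proof -
  define V where "V = to_circle -` A"
  have V [measurable]: "V \<in> sets borel" unfolding V_def by measurable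
  have per: "of_int k + t \<in> V \<longleftrightarrow> t \<in> V" for k t
    by (simp add: V_def to_circle_add_int)
  define k where "k = \<lfloor>a\<rfloor>"
  have k: "of_int k \<le> a" "a < of_int k + 1" unfolding k_def by linarith+
  have t: "to_circle \<in> measurable (restrict_space lborel {0..<1}) borel"
    by (rule measurable_restrict_space1) simp
  have "emeasure circle_lebesgue A = emeasure lborel ({0..<1} \<inter> V)"
    unfolding circle_lebesgue_def V_def
    by (subst emeasure_distr[OF t]) (auto simp: emeasure_restrict_space space_restrict_space Int_commute)
  also have "{0..<1} \<inter> V = ({a - k..<1} \<inter> V) \<union> ({0..<a-k} \<inter> V)" using k by auto
  also have "emeasure lborel \<dots> = emeasure lborel ({a - k..<1} \<inter> V) + emeasure lborel ({0..<a-k} \<inter> V)"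
    by (rule plus_emeasure[symmetric]) auto
  also have "emeasure lborel ({a - k..<1} \<inter> V) = emeasure lborel ({a..<k+1} \<inter> V)"
  proof -
    have "{a - k..<1} \<inter> V = {x. of_int k + x \<in> {a..<k+1} \<inter> V}" by (auto simp: per)
    then show ?thesis by (simp only:) (subst emeasure_lborel_shift, auto)
  qed
  also have "emeasure lborel ({0..<a-k} \<inter> V) = emeasure lborel ({k+1..<a+1} \<inter> V)"
  proof -
    have "{0..<a-k} \<inter> V = {x. of_int (k+1) + x \<in> {k+1..<a+1} \<inter> V}" by (auto simp only: per) auto
    then show ?thesis by (simp only:) (subst emeasure_lborel_shift, auto)
  qed
  also have "emeasure lborel ({a..<k+1} \<inter> V) + emeasure lborel ({k+1..<a+1} \<inter> V)
      = emeasure lborel (({a..<k+1} \<inter> V) \<union> ({k+1..<a+1} \<inter> V))"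
    by (rule plus_emeasure) auto
  also have "({a..<k+1} \<inter> V) \<union> ({k+1..<a+1} \<inter> V) = {a..<a+1} \<inter> V" using k by auto
  finally show ?thesis unfolding V_def .
qed

lemma vimage_to_circle_ball:
  assumes "r \<le> 1 / 2"
  shows "{s - 1/2..<s - 1/2 + 1} \<inter> to_circle -` ball (to_circle s) r = {s - r<..<s + r}"
proof -
  have "t \<in> to_circle -` ball (to_circle s) r \<longleftrightarrow> t \<in> {s - r<..<s + r}"
    if "t \<in> {s - 1/2..<s + 1/2}" for t
  proof -
    have "dist (to_circle s) (to_circle t) = \<bar>s - t\<bar>"
    proof (cases "s - t < 1/2")
      case True
      then have "\<bar>s - t - of_int 0\<bar> < 1/2" using that True unfolding abs_less_iff atLeastLessThan_iff of_int_0 by linarith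
      then have "round (s - t) = 0" by (rule round_unique')
      then show ?thesis by (simp add: dist_to_circle)
    next
      \<comment> \<open>Here \<open>t\<close> is the left end of the window:
        \<open>s - t = 1 / 2\<close> rounds up to 1, and the distance is \<open>1 / 2\<close> all
        the same.\<close>
      case False
      then have st: "s - t = 1/2" using that by auto
      have "round (s - t) = 1" unfolding st by (simp add: round_def)
      then show ?thesis unfolding dist_to_circle st by simp
    qed
    then show ?thesis by (simp add: abs_less_iff) linarith
  qed
  with assms show ?thesis by auto
qed

lemma emeasure_circle_ball:
  assumes "0 \<le> r" "r \<le> 1 / 2"
  shows "emeasure circle_lebesgue (ball c r) = ennreal (2 * r)"
proof -
  define s where "s = rep_circle c"
  have c: "c = to_circle s" by (simp add: s_def to_circle_rep)
  have "emeasure circle_lebesgue (ball c r) = emeasure lborel {s - r<..<s + r}"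
    by (subst emeasure_circle_lebesgue[of _ "s - 1/2"])
       (simp_all only: c vimage_to_circle_ball[OF assms(2)] borel_open open_ball)
  then show ?thesis using assms by simp
qed

lemma emeasure_circle_ball_le:
  assumes "0 \<le> r"
  shows "emeasure circle_lebesgue (ball c r) \<le> ennreal (2 * r)"
proof (cases "r \<le> 1/2")
  case True
  then show ?thesis using assms by (simp add: emeasure_circle_ball)
next
  case False
  have "emeasure circle_lebesgue (ball c r) \<le> 1"
    using prob_space.measure_le_1[OF prob_space_circle_lebesgue] .
  also have "\<dots> \<le> ennreal (2 * r)" using False by simp
  finally show ?thesis .
qed

text \<open>Rectangles of open balls with rational centres exhaust the strip, so it is a countable
  union of measurable rectangles. The measurability of the distance rests on this.\<close>

lemma ball_dist_circle_eq:
  "{p \<in> space (borel \<Otimes>\<^sub>M borel). dist (fst p) (snd p) < r} =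
    (\<Union>q\<in>\<rat>. \<Union>k. ball (to_circle q) (1 / real (Suc k)) \<times> ball (to_circle q) (r - 1 / real (Suc k)))"
proof (intro set_eqI iffI)
  fix p :: "circle \<times> circle"
  assume "p \<in> {p \<in> space (borel \<Otimes>\<^sub>M borel). dist (fst p) (snd p) < r}"
  \<comment> \<open>Half of the slack, because \<open>1 / Suc k\<close> is spent twice: on replacing
    the first point by a rational one and on the radius of the second ball.\<close>
  then have d: "0 < (r - dist (fst p) (snd p)) / 2" by simp
  obtain k where k: "1 / real (Suc k) < (r - dist (fst p) (snd p)) / 2"
    using nat_approx_posE[OF d] by blast
  define s where "s = rep_circle (fst p)"
  have s: "fst p = to_circle s" by (simp add: s_def to_circle_rep)
  obtain q where q: "q \<in> \<rat>" "s < q" "q < s + 1 / real (Suc k)"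
    using Rats_dense_in_real[of s "s + 1 / real (Suc k)"] by auto
  have "dist (to_circle q) (fst p) < 1 / real (Suc k)"
    using dist_to_circle_le[of q s] q unfolding s dist_real_def by linarith
  moreover have "dist (to_circle q) (snd p) \<le> dist (to_circle q) (fst p) + dist (fst p) (snd p)"
    by (rule dist_triangle)
  ultimately show "p \<in> (\<Union>q\<in>\<rat>. \<Union>k. ball (to_circle q) (1 / real (Suc k)) \<times> ball (to_circle q) (r - 1 / real (Suc k)))"
    using q(1) k by (intro UN_I[of q] UN_I[of k]) (auto simp: mem_Times_iff)
next
  fix p :: "circle \<times> circle"
  assume "p \<in> (\<Union>q\<in>\<rat>. \<Union>k. ball (to_circle q) (1 / real (Suc k)) \<times> ball (to_circle q) (r - 1 / real (Suc k)))"
  then obtain q k where "dist (to_circle q) (fst p) < 1 / real (Suc k)"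
     "dist (to_circle q) (snd p) < r - 1 / real (Suc k)"
    by (auto simp: mem_Times_iff)
  moreover have "dist (fst p) (snd p) \<le> dist (to_circle q) (fst p) + dist (to_circle q) (snd p)"
    by (rule dist_triangle3)
  ultimately show "p \<in> {p \<in> space (borel \<Otimes>\<^sub>M borel). dist (fst p) (snd p) < r}"
    by (simp add: space_pair_measure)
qed

lemma measurable_dist_circle [measurable]:
  assumes [measurable]: "g \<in> measurable M (borel :: circle measure)" "h \<in> measurable M borel"
  shows "(\<lambda>x. dist (g x) (h x)) \<in> borel_measurable M"
proof -
  have "(\<lambda>p :: circle \<times> circle. dist (fst p) (snd p)) \<in> borel_measurable (borel \<Otimes>\<^sub>M borel)"
    unfolding borel_measurable_iff_less ball_dist_circle_eq
    by (intro allI sets.countable_UN'' countable_rat sets.countable_UN' pair_measureI borel_open open_ball) auto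
  from measurable_compose[OF _ this, of "\<lambda>x. (g x, h x)" M]
  show ?thesis by simp
qed

section \<open>Independent centres\<close>

text \<open>The integrand depends on finitely many coordinates, so it may be integrated over the
  finite product, where Fubini factors it. This is the form in which independence of the centres is
  used.\<close>

lemma nn_integral_PiM_prod:
  assumes "prob_space \<mu>" "finite J"
    and [measurable]: "\<And>i. i \<in> J \<Longrightarrow> h i \<in> borel_measurable \<mu>"
  shows "(\<integral>\<^sup>+\<omega>. (\<Prod>i\<in>J. h i (\<omega> i)) \<partial>(\<Pi>\<^sub>M i\<in>UNIV. \<mu>)) = (\<Prod>i\<in>J. \<integral>\<^sup>+w. h i w \<partial>\<mu>)"
proof -
  interpret prob_space \<mu> by fact
  interpret P: product_prob_space "\<lambda>_. \<mu>" UNIV ..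
  have "(\<Prod>i\<in>J. \<integral>\<^sup>+w. h i w \<partial>\<mu>) = (\<integral>\<^sup>+x. (\<Prod>i\<in>J. h i (x i)) \<partial>(\<Pi>\<^sub>M i\<in>J. \<mu>))"
    using assms by (subst P.product_nn_integral_prod) auto
  also have "\<dots> = (\<integral>\<^sup>+x. (\<Prod>i\<in>J. h i (x i)) \<partial>(distr (\<Pi>\<^sub>M i\<in>UNIV. \<mu>) (\<Pi>\<^sub>M i\<in>J. \<mu>) (\<lambda>x. restrict x J)))"
    using assms by (subst P.distr_PiM_restrict_finite) auto
  also have "\<dots> = (\<integral>\<^sup>+x. (\<Prod>i\<in>J. h i (restrict x J i)) \<partial>(\<Pi>\<^sub>M i\<in>UNIV. \<mu>))"
    by (subst nn_integral_distr) auto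
  also have "\<dots> = (\<integral>\<^sup>+x. (\<Prod>i\<in>J. h i (x i)) \<partial>(\<Pi>\<^sub>M i\<in>UNIV. \<mu>))"
    by (intro nn_integral_cong prod.cong) auto
  finally show ?thesis by simp
qed

lemma emeasure_PiM_all_in:
  assumes "prob_space \<mu>" "finite J" and [measurable]: "\<And>i. i \<in> J \<Longrightarrow> B i \<in> sets \<mu>"
  shows "emeasure (\<Pi>\<^sub>M i\<in>UNIV. \<mu>) {\<omega> \<in> space (\<Pi>\<^sub>M i\<in>UNIV. \<mu>). \<forall>i\<in>J. \<omega> i \<in> B i} = (\<Prod>i\<in>J. emeasure \<mu> (B i))"
proof -
  have "{\<omega> \<in> space (\<Pi>\<^sub>M i\<in>UNIV. \<mu>). \<forall>i\<in>J. \<omega> i \<in> B i} \<in> sets (\<Pi>\<^sub>M i\<in>UNIV. \<mu>)"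
    using assms(2) by measurable
  then have "emeasure (\<Pi>\<^sub>M i\<in>UNIV. \<mu>) {\<omega> \<in> space (\<Pi>\<^sub>M i\<in>UNIV. \<mu>). \<forall>i\<in>J. \<omega> i \<in> B i}
     = (\<integral>\<^sup>+\<omega>. indicator {\<omega> \<in> space (\<Pi>\<^sub>M i\<in>UNIV. \<mu>). \<forall>i\<in>J. \<omega> i \<in> B i} \<omega> \<partial>(\<Pi>\<^sub>M i\<in>UNIV. \<mu>))"
    by simp
  also have "\<dots> = (\<integral>\<^sup>+\<omega>. (\<Prod>i\<in>J. indicator (B i) (\<omega> i)) \<partial>(\<Pi>\<^sub>M i\<in>UNIV. \<mu>))"
    using assms(2) by (intro nn_integral_cong) (auto simp: indicator_def prod_zero_iff)
  also have "\<dots> = (\<Prod>i\<in>J. \<integral>\<^sup>+w. indicator (B i) w \<partial>\<mu>)"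
    using assms by (intro nn_integral_PiM_prod) auto
  also have "\<dots> = (\<Prod>i\<in>J. emeasure \<mu> (B i))"
    by (intro prod.cong) auto
  finally show ?thesis .
qed

text \<open>Compactness: the arcs with index at least \<open>n0\<close> form an open cover, and
  finitely many of them suffice.\<close>

lemma covers_circle_finite_subcover:
  assumes "covers_circle l \<omega>"
  obtains N where "N \<ge> n0" "\<And>x. \<exists>n\<in>{n0..N}. dist (\<omega> n) x < l n / 2"
proof -
  have "UNIV \<subseteq> (\<Union>n\<in>{n0..}. ball (\<omega> n) (l n / 2))"
  proof
    fix x
    have "infinite {n. n \<ge> 1 \<and> x \<in> arc_at (\<omega> n) (l n)}"
      using assms by (simp add: covers_circle_def)
    then show "x \<in> (\<Union>n\<in>{n0..}. ball (\<omega> n) (l n / 2))"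
      unfolding infinite_nat_iff_unbounded_le arc_at_eq_ball by blast
  qed
  then obtain F where F: "F \<subseteq> {n0..}" "finite F" "UNIV \<subseteq> (\<Union>n\<in>F. ball (\<omega> n) (l n / 2))"
    by (rule compactE_image[OF compact_UNIV_circle, rotated]) auto
  define N where "N = Max (insert n0 F)"
  show thesis
  proof
    show "N \<ge> n0" using F(2) by (simp add: N_def)
    fix x
    obtain n where "n \<in> F" "dist (\<omega> n) x < l n / 2" using F(3) by fastforce
    moreover from this have "n \<le> N" "n0 \<le> n" using F by (auto simp: N_def)
    ultimately show "\<exists>n\<in>{n0..N}. dist (\<omega> n) x < l n / 2" by auto
  qed
qed

text \<open>Expand \<open>(t * x - 1)\<^sup>2 \<ge> 0\<close>. Integrated, this bounds the mean by
  the second moment and the probability of being positive; the free \<open>t\<close> replaces the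
  optimisation in the Cauchy-Schwarz inequality, so neither square roots nor quotients of extended
  reals occur.\<close>

lemma ennreal_le_am_gm:
  fixes X :: ennreal and t :: real
  assumes t: "t > 0"
  shows "X \<le> ennreal (t / 2) * (X * X) + ennreal (1 / (2 * t)) * indicator {0<..} X"
proof (cases X)
  case (real x)
  show ?thesis
  proof (cases "x = 0")
    case False
    with real have x: "x > 0" by simp
    have "0 \<le> (t * x - 1)\<^sup>2 / (2 * t)" using t by simp
    also have "\<dots> = t / 2 * (x * x) + 1 / (2 * t) - x"
      using t by (simp add: power2_eq_square field_simps)
    finally have "x \<le> t / 2 * (x * x) + 1 / (2 * t)" by simp
    then have "ennreal x \<le> ennreal (t / 2 * (x * x) + 1 / (2 * t))" by (rule ennreal_leI)
    also have "\<dots> = ennreal (t / 2) * (X * X) + ennreal (1 / (2 * t)) * indicator {0<..} X"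
      using real x t by (simp add: ennreal_plus flip: ennreal_mult)
    finally show ?thesis using real by simp
  qed (use real in simp)
next
  case top
  then show ?thesis using t by (simp add: ennreal_mult_top)
qed

text \<open>Each new factor increases the product by the previous product times
  \<open>q N * b N\<close>, and the previous product is largest when every \<open>b\<close> is 1.
  The right side is linear in the \<open>b n\<close>, so it can be integrated when these are
  indicators.\<close>

lemma prod_le_telescope:
  fixes q b :: "nat \<Rightarrow> real"
  assumes "\<And>n. n \<ge> a \<Longrightarrow> 0 \<le> q n" "\<And>n. b n \<in> {0, 1}"
  shows "(\<Prod>n\<in>{a..<N}. 1 + q n * b n) \<le> 1 + (\<Sum>n\<in>{a..<N}. q n * (\<Prod>k\<in>{a..<n}. 1 + q k) * b n)"
proof (induction N)
  case (Suc N)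
  show ?case
  proof (cases "a \<le> N")
    case True
    have "(\<Prod>n\<in>{a..<N}. 1 + q n * b n) \<le> (\<Prod>n\<in>{a..<N}. 1 + q n)"
    proof (intro prod_mono conjI)
      fix n assume "n \<in> {a..<N}"
      then have "0 \<le> q n" using assms by auto
      then show "0 \<le> 1 + q n * b n" "1 + q n * b n \<le> 1 + q n" using assms(2)[of n] by auto
    qed
    moreover have "0 \<le> q N * b N" using assms(1)[OF True] assms(2)[of N] by auto
    ultimately have "(\<Prod>n\<in>{a..<N}. 1 + q n * b n) * (q N * b N) \<le> (\<Prod>n\<in>{a..<N}. 1 + q n) * (q N * b N)"
      by (rule mult_right_mono)
    with Suc True show ?thesis by (simp add: algebra_simps)
  qed simp
qed simp

section \<open>Second moment criterion for not covering\<close>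

text \<open>\<open>px\<close> and \<open>py\<close> are the probabilities of hitting two points and
  \<open>e\<close> that of hitting both; the quotient compares missing both with independent misses.
  Without \<open>e\<close> it is at most 1, since \<open>1 - px - py\<close> is
  \<open>(1 - px) * (1 - py)\<close> minus \<open>px * py\<close>.\<close>

lemma pair_avoid_bound:
  fixes px py p e b :: real
  assumes "0 \<le> px" "px \<le> p" "0 \<le> py" "py \<le> p" "p \<le> 1 / 2"
    and "e \<le> p * b" "b \<in> {0, 1}"
  shows "(1 - px - py + e) / ((1 - px) * (1 - py)) \<le> 1 + p / (1 - p)\<^sup>2 * b"
proof -
  have pos: "0 < (1 - p)\<^sup>2" "(1 - p)\<^sup>2 \<le> (1 - px) * (1 - py)"
    using assms unfolding power2_eq_square by (auto intro!: mult_mono)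
  have "p * b = p / (1 - p)\<^sup>2 * b * (1 - p)\<^sup>2" using pos by simp
  also have "\<dots> \<le> p / (1 - p)\<^sup>2 * b * ((1 - px) * (1 - py))"
    using assms pos by (intro mult_left_mono) auto
  finally have "p * b \<le> p / (1 - p)\<^sup>2 * b * ((1 - px) * (1 - py))" .
  moreover have "1 - px - py \<le> (1 - px) * (1 - py)" using assms by (simp add: algebra_simps)
  ultimately have "1 - px - py + e \<le> (1 + p / (1 - p)\<^sup>2 * b) * ((1 - px) * (1 - py))"
    using assms(6) by (simp add: algebra_simps)
  then show ?thesis using less_le_trans[OF pos] by (simp only: pos_divide_le_eq)
qed

lemma ennreal_one_plus_sum:
  assumes "\<And>i. i \<in> I \<Longrightarrow> 0 \<le> f i"
  shows "ennreal (1 + (\<Sum>i\<in>I. f i)) = 1 + (\<Sum>i\<in>I. ennreal (f i))"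
proof -
  have "ennreal (1 + (\<Sum>i\<in>I. f i)) = ennreal 1 + ennreal (\<Sum>i\<in>I. f i)"
    using assms by (intro ennreal_plus sum_nonneg) auto
  with assms show ?thesis by (simp add: sum_ennreal)
qed

text \<open>Points at distance at least \<open>l n\<close> cannot both lie in the
  \<open>n\<close>-th arc, so misses are positively correlated only for points closer than that, a
  ball of measure at most \<open>2 * l n\<close>. Hence the normalised uncovered mass of
  \<open>A\<close> has bounded second moment and positive mean, and cannot vanish with probability
  tending to 1.\<close>

lemma not_covered_second_moment:
  fixes \<mu> :: "circle measure" and p l :: "nat \<Rightarrow> real" and C :: real
  assumes "prob_space \<mu>" and sets_mu [measurable_cong]: "sets \<mu> = sets borel"
    and A [measurable]: "A \<in> sets borel" and A_pos: "emeasure circle_lebesgue A > 0"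
    and p: "\<And>n. n \<ge> n0 \<Longrightarrow> 0 \<le> p n \<and> p n \<le> 1 / 2"
    and ball_le: "\<And>n x. n \<ge> n0 \<Longrightarrow> x \<in> A \<Longrightarrow> measure \<mu> (ball x (l n / 2)) \<le> p n"
    and l: "\<And>n. n \<ge> n0 \<Longrightarrow> 0 \<le> l n"
    and bound: "\<And>N. (\<Sum>n\<in>{n0..<N}. l n * (p n / (1 - p n)\<^sup>2) *
                    (\<Prod>k\<in>{n0..<n}. 1 + p k / (1 - p k)\<^sup>2)) \<le> C"
  shows "\<not> (AE \<omega> in (\<Pi>\<^sub>M n\<in>UNIV. \<mu>). covers_circle l \<omega>)"
proof
  assume cov: "AE \<omega> in (\<Pi>\<^sub>M n\<in>UNIV. \<mu>). covers_circle l \<omega>"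
  interpret mu: prob_space \<mu> by fact
  interpret L: prob_space circle_lebesgue by (rule prob_space_circle_lebesgue)
  define M where "M = (\<Pi>\<^sub>M n\<in>(UNIV :: nat set). \<mu>)"
  interpret M: prob_space M unfolding M_def using assms(1) by (intro prob_space_PiM)
  interpret PP: pair_sigma_finite M circle_lebesgue ..
  define q where "q n = p n / (1 - p n)\<^sup>2" for n
  have q: "0 \<le> q n" if "n \<ge> n0" for n using p[OF that] by (simp add: q_def)
  have space_mu: "space \<mu> = UNIV" using sets_eq_imp_space_eq[OF sets_mu] by simp
  have comp: "(\<lambda>\<omega>. \<omega> n) \<in> measurable M borel" for n
    using measurable_component_singleton[of n UNIV "\<lambda>_. \<mu>"] sets_mu
    by (simp add: M_def cong: measurable_cong_sets)
  \<comment> \<open>\<open>h n x w\<close> says that the arc centred at \<open>w\<close> misses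
    \<open>x\<close>; \<open>c n x\<close> will be the probability of this, and \<open>G\<close> the
    miss indicator rescaled to have mean 1 for \<open>x\<close> in \<open>A\<close>.\<close>
  define h where "h n x w = (if l n / 2 \<le> dist x w then 1 else 0 :: ennreal)" for n and x w :: circle
  have h_meas [measurable]: "(\<lambda>z. h n (u z) (v z)) \<in> borel_measurable K"
    if [measurable]: "u \<in> measurable K borel" "v \<in> measurable K borel" for n u v and K :: "'z measure"
    unfolding h_def by measurable
  have h_sec [measurable]: "h n x \<in> borel_measurable \<mu>" for n x
    unfolding h_def[abs_def] by measurable
  define c where "c n x = enn2real (\<integral>\<^sup>+w. h n x w \<partial>\<mu>)" for n x
  have c_meas [measurable]: "c n \<in> borel_measurable borel" for n
    unfolding c_def by measurable
  define G where "G n x w = h n x w * ennreal (1 / c n x)" for n x w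
  have G_meas [measurable]: "(\<lambda>z. G n (u z) (v z)) \<in> borel_measurable K"
    if [measurable]: "u \<in> measurable K borel" "v \<in> measurable K borel" for n u v and K :: "'z measure"
    unfolding G_def by measurable
  have G_sec [measurable]: "G n x \<in> borel_measurable \<mu>" for n x
    unfolding G_def[abs_def] by measurable
  have ball_sets [measurable]: "ball x r \<in> sets \<mu>" for x r by (simp add: sets_mu)
  have c: "c n x = 1 - measure \<mu> (ball x (l n / 2))" for n x
  proof -
    have "(\<integral>\<^sup>+w. h n x w \<partial>\<mu>) = (\<integral>\<^sup>+w. indicator (space \<mu> - ball x (l n / 2)) w \<partial>\<mu>)"
      by (intro nn_integral_cong) (auto simp: h_def indicator_def space_mu)
    also have "\<dots> = emeasure \<mu> (space \<mu> - ball x (l n / 2))" by (rule nn_integral_indicator) measurable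
    finally show ?thesis
      unfolding c_def by (simp add: mu.prob_compl flip: measure_def)
  qed
  have int_h: "(\<integral>\<^sup>+w. h n x w \<partial>\<mu>) = ennreal (c n x)" for n x
  proof -
    have "(\<integral>\<^sup>+w. h n x w \<partial>\<mu>) \<le> (\<integral>\<^sup>+w. 1 \<partial>\<mu>)" by (intro nn_integral_mono) (auto simp: h_def)
    then have "(\<integral>\<^sup>+w. h n x w \<partial>\<mu>) \<le> 1" by (simp add: mu.emeasure_space_1)
    then show ?thesis unfolding c_def by (subst ennreal_enn2real) (auto simp: top_unique less_top[symmetric])
  qed
  have c_ge: "1 / 2 \<le> c n x" if "n \<ge> n0" "x \<in> A" for n x
    using ball_le[OF that] p[OF that(1)] by (simp add: c)
  have first: "(\<integral>\<^sup>+w. G n x w \<partial>\<mu>) = 1" if "n \<ge> n0" "x \<in> A" for n x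
  proof -
    have "(\<integral>\<^sup>+w. G n x w \<partial>\<mu>) = ennreal (c n x) * ennreal (1 / c n x)"
      unfolding G_def by (subst nn_integral_multc) (simp_all add: int_h)
    also have "\<dots> = 1" using c_ge[OF that] by (simp flip: ennreal_mult)
    finally show ?thesis .
  qed
  \<comment> \<open>Only for \<open>dist x y < l n\<close> can the balls of radius
    \<open>l n / 2\<close> about \<open>x\<close> and \<open>y\<close> meet.\<close>
  define b where "b n x y = (if dist x y < l n then 1 else 0 :: real)" for n and x y :: circle
  have b01: "b n x y \<in> {0, 1}" for n x y by (simp add: b_def)
  have second: "(\<integral>\<^sup>+w. G n x w * G n y w \<partial>\<mu>) \<le> ennreal (1 + q n * b n x y)"
    if n: "n \<ge> n0" and x: "x \<in> A" and y: "y \<in> A" for n x y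
  proof -
    let ?X = "ball x (l n / 2)" and ?Y = "ball y (l n / 2)"
    have e: "measure \<mu> (?X \<inter> ?Y) \<le> p n * b n x y"
    proof (cases "dist x y < l n")
      case True
      have "measure \<mu> (?X \<inter> ?Y) \<le> measure \<mu> ?X" by (intro mu.finite_measure_mono) auto
      with ball_le[OF n x] True show ?thesis by (simp add: b_def)
    next
      case False
      have "?X \<inter> ?Y = {}"
      proof (rule ccontr)
        assume "?X \<inter> ?Y \<noteq> {}"
        then obtain w where "dist x w < l n / 2" "dist y w < l n / 2" by auto
        with dist_triangle2[of x y w] False show False by linarith
      qed
      then show ?thesis by (simp add: b_def False)
    qed
    have "measure \<mu> (space \<mu> - (?X \<union> ?Y)) = 1 - measure \<mu> ?X - measure \<mu> ?Y + measure \<mu> (?X \<inter> ?Y)"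
      using mu.finite_measure_Union'[of ?X ?Y] mu.finite_measure_Diff'[of ?Y ?X]
      by (simp add: mu.prob_compl Int_commute)
    then have eq: "(\<integral>\<^sup>+w. h n x w * h n y w \<partial>\<mu>)
      = ennreal (1 - measure \<mu> ?X - measure \<mu> ?Y + measure \<mu> (?X \<inter> ?Y))"
    proof -
      have "(\<integral>\<^sup>+w. h n x w * h n y w \<partial>\<mu>) = (\<integral>\<^sup>+w. indicator (space \<mu> - (?X \<union> ?Y)) w \<partial>\<mu>)"
        by (intro nn_integral_cong) (auto simp: h_def indicator_def space_mu)
      also have "\<dots> = emeasure \<mu> (space \<mu> - (?X \<union> ?Y))" by (rule nn_integral_indicator) measurable
      finally show ?thesis by (simp only: mu.emeasure_eq_measure \<open>measure \<mu> (space \<mu> - (?X \<union> ?Y)) = _\<close>)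
    qed
    have nonneg: "0 \<le> 1 - measure \<mu> ?X - measure \<mu> ?Y + measure \<mu> (?X \<inter> ?Y)"
      by (metis \<open>measure \<mu> (space \<mu> - (?X \<union> ?Y)) = _\<close> measure_nonneg)
    have "(\<integral>\<^sup>+w. G n x w * G n y w \<partial>\<mu>)
       = (\<integral>\<^sup>+w. h n x w * h n y w * (ennreal (1 / c n x) * ennreal (1 / c n y)) \<partial>\<mu>)"
      by (intro nn_integral_cong) (simp add: G_def mult_ac)
    also have "\<dots> = (\<integral>\<^sup>+w. h n x w * h n y w \<partial>\<mu>) * (ennreal (1 / c n x) * ennreal (1 / c n y))"
      by (rule nn_integral_multc) measurable
    also have "\<dots> = ennreal ((1 - measure \<mu> ?X - measure \<mu> ?Y + measure \<mu> (?X \<inter> ?Y)) / (c n x * c n y))"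
      unfolding eq using nonneg c_ge[OF n x] c_ge[OF n y] by (simp flip: ennreal_mult)
    also have "\<dots> \<le> ennreal (1 + q n * b n x y)"
      unfolding c q_def
      by (intro ennreal_leI pair_avoid_bound ball_le n x y e b01 measure_nonneg conjunct2[OF p])
    finally show ?thesis .
  qed
  \<comment> \<open>\<open>X N\<close> is the mass of the uncovered part of \<open>A\<close>, normalised so that its mean is \<open>|A|\<close>; it vanishes
    eventually if the circle is covered, but its second moment stays bounded.\<close>
  define X where "X N \<omega> = (\<integral>\<^sup>+x. indicator A x * (\<Prod>n\<in>{n0..<N}. G n x (\<omega> n)) \<partial>circle_lebesgue)" for N \<omega>
  have inner_meas: "(\<lambda>x. indicator A x * (\<Prod>n\<in>{n0..<N}. G n x (\<omega> n))) \<in> borel_measurable circle_lebesgue"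
    for N and \<omega> :: "nat \<Rightarrow> circle"
    by measurable
  note comp [measurable]
  have X_meas [measurable]: "X N \<in> borel_measurable M" for N
    unfolding X_def by measurable
  have EX: "(\<integral>\<^sup>+\<omega>. X N \<omega> \<partial>M) = emeasure circle_lebesgue A" for N
  proof -
    have "(\<integral>\<^sup>+\<omega>. X N \<omega> \<partial>M)
      = (\<integral>\<^sup>+x. (\<integral>\<^sup>+\<omega>. indicator A x * (\<Prod>n\<in>{n0..<N}. G n x (\<omega> n)) \<partial>M) \<partial>circle_lebesgue)"
      unfolding X_def by (rule PP.Fubini'[symmetric]) measurable
    also have "\<dots> = (\<integral>\<^sup>+x. indicator A x \<partial>circle_lebesgue)"
    proof (intro nn_integral_cong)
      fix x
      have "(\<integral>\<^sup>+\<omega>. indicator A x * (\<Prod>n\<in>{n0..<N}. G n x (\<omega> n)) \<partial>M)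
        = indicator A x * (\<Prod>n\<in>{n0..<N}. (\<integral>\<^sup>+w. G n x w \<partial>\<mu>))"
        unfolding M_def by (subst nn_integral_cmult, use comp in \<open>simp add: M_def[symmetric]\<close>,
            subst nn_integral_PiM_prod) (auto intro: \<open>prob_space \<mu>\<close>)
      also have "\<dots> = indicator A x"
        by (cases "x \<in> A") (auto simp: first intro!: prod.neutral)
      finally show "(\<integral>\<^sup>+\<omega>. indicator A x * (\<Prod>n\<in>{n0..<N}. G n x (\<omega> n)) \<partial>M) = indicator A x" .
    qed
    finally show ?thesis by simp
  qed
  define C' where "C' = max 0 (1 + 2 * C)"
  have C'_nonneg: "0 \<le> C'" by (simp add: C'_def)
  have EXX: "(\<integral>\<^sup>+\<omega>. X N \<omega> * X N \<omega> \<partial>M) \<le> ennreal C'" for N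
  proof -
    let ?g = "\<lambda>x \<omega>. indicator A x * (\<Prod>n\<in>{n0..<N}. G n x (\<omega> n)) :: ennreal"
    have "(\<integral>\<^sup>+\<omega>. X N \<omega> * X N \<omega> \<partial>M)
      = (\<integral>\<^sup>+\<omega>. (\<integral>\<^sup>+x. X N \<omega> * ?g x \<omega> \<partial>circle_lebesgue) \<partial>M)"
      by (intro nn_integral_cong, subst nn_integral_cmult[OF inner_meas]) (simp add: X_def)
    also have "\<dots> = (\<integral>\<^sup>+x. (\<integral>\<^sup>+\<omega>. X N \<omega> * ?g x \<omega> \<partial>M) \<partial>circle_lebesgue)"
      by (rule PP.Fubini'[symmetric]) measurable
    also have "\<dots> = (\<integral>\<^sup>+x. (\<integral>\<^sup>+\<omega>. (\<integral>\<^sup>+y. ?g y \<omega> * ?g x \<omega> \<partial>circle_lebesgue) \<partial>M) \<partial>circle_lebesgue)"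
      by (intro nn_integral_cong, subst nn_integral_multc[OF inner_meas]) (simp add: X_def)
    also have "\<dots> = (\<integral>\<^sup>+x. (\<integral>\<^sup>+y. (\<integral>\<^sup>+\<omega>. ?g y \<omega> * ?g x \<omega> \<partial>M) \<partial>circle_lebesgue) \<partial>circle_lebesgue)"
      by (intro nn_integral_cong PP.Fubini'[symmetric]) measurable
    also have "\<dots> \<le> (\<integral>\<^sup>+x. ennreal C' \<partial>circle_lebesgue)"
    proof (intro nn_integral_mono)
      fix x
      let ?P = "\<lambda>n. \<Prod>k\<in>{n0..<n}. 1 + q k"
      have P0: "0 \<le> ?P n" for n using q by (intro prod_nonneg) (auto simp: add_nonneg_nonneg)
      have "(\<integral>\<^sup>+y. (\<integral>\<^sup>+\<omega>. ?g y \<omega> * ?g x \<omega> \<partial>M) \<partial>circle_lebesgue)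
        \<le> (\<integral>\<^sup>+y. 1 + (\<Sum>n\<in>{n0..<N}. ennreal (q n * ?P n) * indicator (ball x (l n)) y) \<partial>circle_lebesgue)"
      proof (intro nn_integral_mono)
        fix y
        show "(\<integral>\<^sup>+\<omega>. ?g y \<omega> * ?g x \<omega> \<partial>M)
          \<le> 1 + (\<Sum>n\<in>{n0..<N}. ennreal (q n * ?P n) * indicator (ball x (l n)) y)"
        proof (cases "x \<in> A \<and> y \<in> A")
          case True
          then have x: "x \<in> A" and y: "y \<in> A" by auto
          have "(\<integral>\<^sup>+\<omega>. ?g y \<omega> * ?g x \<omega> \<partial>M) = (\<integral>\<^sup>+\<omega>. (\<Prod>n\<in>{n0..<N}. G n x (\<omega> n) * G n y (\<omega> n)) \<partial>M)"
            using x y by (intro nn_integral_cong) (simp add: prod.distrib mult.commute)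
          also have "\<dots> = (\<Prod>n\<in>{n0..<N}. (\<integral>\<^sup>+w. G n x w * G n y w \<partial>\<mu>))"
            unfolding M_def by (subst nn_integral_PiM_prod) (auto intro: \<open>prob_space \<mu>\<close>)
          also have "\<dots> \<le> (\<Prod>n\<in>{n0..<N}. ennreal (1 + q n * b n x y))"
            using x y by (intro prod_mono_ennreal second) auto
          also have "\<dots> = ennreal (\<Prod>n\<in>{n0..<N}. 1 + q n * b n x y)"
            using q by (intro prod_ennreal) (auto simp: b_def add_nonneg_nonneg)
          also have "\<dots> \<le> ennreal (1 + (\<Sum>n\<in>{n0..<N}. q n * ?P n * b n x y))"
            using q b01 by (intro ennreal_leI prod_le_telescope) auto
          also have "\<dots> = 1 + (\<Sum>n\<in>{n0..<N}. ennreal (q n * ?P n * b n x y))"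
          proof -
            have "0 \<le> q n * ?P n * b n x y" if "n \<in> {n0..<N}" for n
              using q P0 that by (auto simp: b_def intro!: mult_nonneg_nonneg)
            then show ?thesis by (rule ennreal_one_plus_sum)
          qed
          also have "\<dots> = 1 + (\<Sum>n\<in>{n0..<N}. ennreal (q n * ?P n) * indicator (ball x (l n)) y)"
            by (intro arg_cong2[where f="(+)"] sum.cong refl) (auto simp: b_def indicator_def)
          finally show ?thesis .
        qed auto
      qed
      also have "\<dots> = 1 + (\<Sum>n\<in>{n0..<N}. ennreal (q n * ?P n) * emeasure circle_lebesgue (ball x (l n)))"
      proof -
        have [measurable]: "ball x r \<in> sets borel" for r :: real by simp
        have "(\<integral>\<^sup>+y. 1 + (\<Sum>n\<in>{n0..<N}. ennreal (q n * ?P n) * indicator (ball x (l n)) y) \<partial>circle_lebesgue)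
          = (\<integral>\<^sup>+y. 1 \<partial>circle_lebesgue) +
            (\<integral>\<^sup>+y. (\<Sum>n\<in>{n0..<N}. ennreal (q n * ?P n) * indicator (ball x (l n)) y) \<partial>circle_lebesgue)"
          by (rule nn_integral_add) measurable
        also have "(\<integral>\<^sup>+y. (\<Sum>n\<in>{n0..<N}. ennreal (q n * ?P n) * indicator (ball x (l n)) y) \<partial>circle_lebesgue)
          = (\<Sum>n\<in>{n0..<N}. \<integral>\<^sup>+y. ennreal (q n * ?P n) * indicator (ball x (l n)) y \<partial>circle_lebesgue)"
          by (rule nn_integral_sum) measurable
        finally show ?thesis using L.emeasure_space_1 by (simp add: nn_integral_cmult)
      qed
      \<comment> \<open>The measure of the ball supplies the factor \<open>l n\<close> of the
        assumed bound.\<close>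
      also have "\<dots> \<le> 1 + (\<Sum>n\<in>{n0..<N}. ennreal (q n * ?P n) * ennreal (2 * l n))"
        using l by (intro add_left_mono sum_mono mult_left_mono emeasure_circle_ball_le) auto
      also have "\<dots> = 1 + (\<Sum>n\<in>{n0..<N}. ennreal (2 * (l n * q n * ?P n)))"
        using l q P0 by (intro arg_cong2[where f="(+)"] sum.cong refl) (auto simp: mult_ac simp flip: ennreal_mult)
      also have "\<dots> = ennreal (1 + 2 * (\<Sum>n\<in>{n0..<N}. l n * q n * ?P n))"
      proof -
        have "0 \<le> 2 * (l n * q n * ?P n)" if "n \<in> {n0..<N}" for n
          using l q P0 that by (auto intro!: mult_nonneg_nonneg)
        then show ?thesis unfolding sum_distrib_left by (rule ennreal_one_plus_sum[symmetric])
      qed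
      also have "\<dots> \<le> ennreal C'"
        using bound[of N] unfolding C'_def q_def by (intro ennreal_leI) simp
      finally show "(\<integral>\<^sup>+y. (\<integral>\<^sup>+\<omega>. ?g y \<omega> * ?g x \<omega> \<partial>M) \<partial>circle_lebesgue) \<le> ennreal C'" .
    qed
    also have "\<dots> = ennreal C'" using L.emeasure_space_1 by simp
    finally show ?thesis .
  qed
  define D where "D N = {\<omega> \<in> space M. X N \<omega> \<in> {0<..}}" for N
  have D_meas [measurable]: "D N \<in> sets M" for N unfolding D_def by measurable
  have D_lim: "(\<lambda>N. measure M (D N)) \<longlonglongrightarrow> 0"
  proof -
    have "(\<lambda>N. \<integral>\<omega>. indicator (D N) \<omega> \<partial>M :: real) \<longlonglongrightarrow> (\<integral>\<omega>. 0 \<partial>M)"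
    proof (rule integral_dominated_convergence[where w="\<lambda>_. 1"])
      show "AE \<omega> in M. (\<lambda>N. indicator (D N) \<omega> :: real) \<longlonglongrightarrow> 0"
        using cov unfolding M_def[symmetric]
      proof eventually_elim
        case (elim \<omega>)
        obtain N0 where N0: "N0 \<ge> n0" "\<And>x. \<exists>n\<in>{n0..N0}. dist (\<omega> n) x < l n / 2"
          using covers_circle_finite_subcover[OF elim] by blast
        \<comment> \<open>The product in \<open>X N\<close> stops before \<open>N\<close>, so
          \<open>N > N0\<close> is what makes a vanishing factor available for every point.\<close>
        have "indicator (D N) \<omega> = (0 :: real)" if "N > N0" for N
        proof -
          have "(\<Prod>n\<in>{n0..<N}. G n x (\<omega> n)) = 0" for x
          proof -
            obtain n where n: "n \<in> {n0..N0}" "dist (\<omega> n) x < l n / 2" using N0(2) by blast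
            then have "G n x (\<omega> n) = 0" by (simp add: G_def h_def dist_commute)
            then show ?thesis using n that by (intro prod_zero) auto
          qed
          then have "X N \<omega> = 0" unfolding X_def by (simp only: mult_zero_right nn_integral_const) simp
          then show ?thesis by (simp add: D_def)
        qed
        then have "\<forall>\<^sub>F N in sequentially. indicator (D N) \<omega> = (0 :: real)"
          using eventually_gt_at_top[of N0] by (rule eventually_mono[rotated])
        then show ?case by (rule tendsto_eventually)
      qed
    qed auto
    then show ?thesis by simp
  qed
  define a where "a = measure circle_lebesgue A"
  have a: "emeasure circle_lebesgue A = ennreal a" by (simp add: a_def L.emeasure_eq_measure)
  have a_pos: "a > 0" using A_pos by (simp add: a)
  have est: "a \<le> t / 2 * C' + 1 / (2 * t) * measure M (D N)" if t: "t > 0" for t N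
  proof -
    have "ennreal a = (\<integral>\<^sup>+\<omega>. X N \<omega> \<partial>M)" by (simp add: EX a)
    also have "\<dots> \<le> (\<integral>\<^sup>+\<omega>. ennreal (t / 2) * (X N \<omega> * X N \<omega>) + ennreal (1 / (2 * t)) * indicator {0<..} (X N \<omega>) \<partial>M)"
      by (intro nn_integral_mono ennreal_le_am_gm t)
    also have "\<dots> = (\<integral>\<^sup>+\<omega>. ennreal (t / 2) * (X N \<omega> * X N \<omega>) + ennreal (1 / (2 * t)) * indicator (D N) \<omega> \<partial>M)"
      by (intro nn_integral_cong) (auto simp: D_def indicator_def)
    also have "\<dots> = ennreal (t / 2) * (\<integral>\<^sup>+\<omega>. X N \<omega> * X N \<omega> \<partial>M) + ennreal (1 / (2 * t)) * emeasure M (D N)"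
      by (subst nn_integral_add) (auto simp: nn_integral_cmult)
    also have "\<dots> \<le> ennreal (t / 2) * ennreal C' + ennreal (1 / (2 * t)) * ennreal (measure M (D N))"
      by (intro add_mono mult_left_mono EXX) (auto simp: M.emeasure_eq_measure)
    also have "\<dots> = ennreal (t / 2 * C' + 1 / (2 * t) * measure M (D N))"
      using t C'_nonneg by (simp add: ennreal_plus flip: ennreal_mult)
    finally show ?thesis using t C'_nonneg by (subst (asm) ennreal_le_iff) auto
  qed
  \<comment> \<open>For fixed \<open>t\<close> the limit in \<open>N\<close> removes the probability
    term.\<close>
  have "a \<le> t / 2 * C'" if t: "t > 0" for t
  proof -
    have "(\<lambda>N. t / 2 * C' + 1 / (2 * t) * measure M (D N)) \<longlonglongrightarrow> t / 2 * C' + 1 / (2 * t) * 0"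
      by (intro tendsto_intros D_lim)
    then show ?thesis using est[OF t] by (intro LIMSEQ_le_const[of _ "t / 2 * C'"]) auto
  qed
  \<comment> \<open>This \<open>t\<close> makes the right side less than \<open>a / 2\<close>;
    adding 1 to \<open>C'\<close> keeps the denominator positive.\<close>
  from this[of "a / (C' + 1)"] have "a \<le> a / (C' + 1) / 2 * C'"
    using a_pos C'_nonneg by simp
  moreover have "a / (C' + 1) / 2 * C' < a"
    using a_pos C'_nonneg by (simp add: field_simps add_nonneg_pos)
  ultimately show False by linarith
qed

section \<open>First moment criteria for covering\<close>

text \<open>The exceptional set is not known to be measurable. It lies in events of measure at most
  \<open>1 / Suc k\<close> for every \<open>k\<close>, and their intersection is a measurable null
  set.\<close>

lemma AE_I_small_events:
  assumes "\<And>\<epsilon>::real. \<epsilon> > 0 \<Longrightarrow> \<exists>E\<in>sets M. emeasure M E \<le> ennreal \<epsilon> \<and> {\<omega> \<in> space M. \<not> P \<omega>} \<subseteq> E"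
  shows "AE \<omega> in M. P \<omega>"
proof -
  have "\<exists>E. E \<in> sets M \<and> emeasure M E \<le> ennreal (1 / real (Suc k)) \<and> {\<omega> \<in> space M. \<not> P \<omega>} \<subseteq> E" for k
    using assms[of "1 / real (Suc k)"] by auto
  then obtain E where E: "\<And>k. E k \<in> sets M" "\<And>k. emeasure M (E k) \<le> ennreal (1 / real (Suc k))"
      "\<And>k. {\<omega> \<in> space M. \<not> P \<omega>} \<subseteq> E k"
    by metis
  have "emeasure M (\<Inter>k. E k) \<le> ennreal (1 / real (Suc k))" for k
    using E(1) by (intro order_trans[OF emeasure_mono E(2)]) auto
  moreover have "(\<lambda>k. ennreal (1 / real (Suc k))) \<longlonglongrightarrow> ennreal 0"
    by (intro tendsto_ennrealI) (rule LIMSEQ_Suc[OF lim_1_over_n])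
  ultimately have "emeasure M (\<Inter>k. E k) \<le> ennreal 0"
    by (intro LIMSEQ_le_const) auto
  then show ?thesis using E(1,3) by (intro AE_I[of _ _ "\<Inter>k. E k"]) auto
qed

section \<open>Measures with a density and miss probabilities\<close>

lemma sets_density_measure [simp, measurable_cong]: "sets (density_measure f) = sets borel"
  by (simp add: density_measure_def)

lemma space_density_measure [simp]: "space (density_measure f) = UNIV"
  by (simp add: density_measure_def)

lemma prob_density_borel: "prob_density f \<Longrightarrow> f \<in> borel_measurable borel"
  unfolding prob_density_def by (auto dest!: borel_measurable_integrable simp: cong: measurable_cong_sets)

lemma emeasure_density_measure:
  assumes "prob_density f" "B \<in> sets borel"
  shows "emeasure (density_measure f) B = (\<integral>\<^sup>+x. ennreal (f x) * indicator B x \<partial>circle_lebesgue)"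
  unfolding density_measure_def using assms prob_density_borel[OF assms(1)]
  by (subst emeasure_density) (auto cong: measurable_cong_sets)

lemma density_measure_ball_ge:
  assumes f: "prob_density f" and a: "0 \<le> a"
    and ae: "AE x in circle_lebesgue. x \<in> B \<longrightarrow> a \<le> f x"
    and sub: "ball c \<rho> \<subseteq> B" and \<rho>: "\<rho> \<le> 1 / 2"
  shows "2 * a * \<rho> \<le> measure (density_measure f) (ball c \<rho>)"
proof (cases "\<rho> \<ge> 0")
  case True
  interpret prob_space "density_measure f" by (rule prob_space_density_measure[OF f])
  have "ennreal (2 * a * \<rho>) = ennreal a * emeasure circle_lebesgue (ball c \<rho>)"
    using a True \<rho> by (simp add: emeasure_circle_ball mult_ac flip: ennreal_mult)
  also have "\<dots> = (\<integral>\<^sup>+x. ennreal a * indicator (ball c \<rho>) x \<partial>circle_lebesgue)"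
    by (rule nn_integral_cmult_indicator[symmetric]) simp
  also have "\<dots> \<le> (\<integral>\<^sup>+x. ennreal (f x) * indicator (ball c \<rho>) x \<partial>circle_lebesgue)"
  proof (rule nn_integral_mono_AE)
    show "AE x in circle_lebesgue. ennreal a * indicator (ball c \<rho>) x \<le> ennreal (f x) * indicator (ball c \<rho>) x"
      using ae by eventually_elim (use sub in \<open>auto simp: indicator_def intro: ennreal_leI\<close>)
  qed
  also have "\<dots> = emeasure (density_measure f) (ball c \<rho>)"
    using f by (simp add: emeasure_density_measure)
  finally show ?thesis by (simp add: emeasure_eq_measure)
next
  \<comment> \<open>In the application \<open>\<rho>\<close> is \<open>l n / 2 - d\<close>, which
    may be negative; the bound is then trivial.\<close>
  case False
  then have "2 * a * \<rho> \<le> 0" using a by (simp add: mult_nonneg_nonpos)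
  then show ?thesis by (meson measure_nonneg order_trans)
qed

lemma measurable_component_density [measurable]:
  "(\<lambda>\<omega>. \<omega> n) \<in> measurable (\<Pi>\<^sub>M n\<in>(UNIV :: nat set). density_measure f) borel"
  using measurable_component_singleton[of n UNIV "\<lambda>_. density_measure f"]
  by (simp cong: measurable_cong_sets)

text \<open>The slack \<open>d\<close> serves a whole neighbourhood: an arc that misses some point
  within \<open>d\<close> of \<open>c\<close> has its centre at distance at least
  \<open>l n / 2 - d\<close> from \<open>c\<close>. Independence and
  \<open>1 - u \<le> exp (- u)\<close> turn the product of miss probabilities into the exponential
  of a sum, also where a summand is negative.\<close>

lemma miss_prob_le:
  fixes l :: "nat \<Rightarrow> real"
  assumes f: "prob_density f" and J: "finite J" and a: "0 \<le> a"
    and ae: "AE x in circle_lebesgue. x \<in> B \<longrightarrow> a \<le> f x"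
    and sub: "\<And>n. n \<in> J \<Longrightarrow> ball c (l n / 2 - d) \<subseteq> B"
    and l: "\<And>n. n \<in> J \<Longrightarrow> l n \<le> 1" and d: "0 \<le> d"
  shows "emeasure (\<Pi>\<^sub>M n\<in>UNIV. density_measure f)
      {\<omega> \<in> space (\<Pi>\<^sub>M n\<in>UNIV. density_measure f). \<forall>n\<in>J. l n / 2 - d \<le> dist c (\<omega> n)}
    \<le> ennreal (exp (- a * (\<Sum>n\<in>J. l n - 2 * d)))"
proof -
  interpret prob_space "density_measure f" by (rule prob_space_density_measure[OF f])
  let ?B = "\<lambda>n. UNIV - ball c (l n / 2 - d)"
  have eq: "{\<omega> \<in> space (\<Pi>\<^sub>M n\<in>UNIV. density_measure f). \<forall>n\<in>J. l n / 2 - d \<le> dist c (\<omega> n)}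
    = {\<omega> \<in> space (\<Pi>\<^sub>M n\<in>UNIV. density_measure f). \<forall>n\<in>J. \<omega> n \<in> ?B n}"
    by (auto simp: not_less)
  have "emeasure (\<Pi>\<^sub>M n\<in>UNIV. density_measure f)
      {\<omega> \<in> space (\<Pi>\<^sub>M n\<in>UNIV. density_measure f). \<forall>n\<in>J. l n / 2 - d \<le> dist c (\<omega> n)}
    = (\<Prod>n\<in>J. emeasure (density_measure f) (?B n))"
    unfolding eq by (rule emeasure_PiM_all_in) (auto simp: J prob_space_axioms)
  also have "\<dots> \<le> (\<Prod>n\<in>J. ennreal (exp (- a * (l n - 2 * d))))"
  proof (rule prod_mono_ennreal)
    fix n assume n: "n \<in> J"
    have "2 * a * (l n / 2 - d) \<le> prob (ball c (l n / 2 - d))"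
      using l[OF n] d by (intro density_measure_ball_ge[OF f a ae sub[OF n]]) auto
    moreover have "1 + (- a * (l n - 2 * d)) \<le> exp (- a * (l n - 2 * d))" by (rule exp_ge_add_one_self)
    moreover have "prob (?B n) = 1 - prob (ball c (l n / 2 - d))"
      using prob_compl[of "ball c (l n / 2 - d)"] by simp
    ultimately have "prob (?B n) \<le> exp (- a * (l n - 2 * d))" by (simp add: algebra_simps)
    then show "emeasure (density_measure f) (?B n) \<le> ennreal (exp (- a * (l n - 2 * d)))"
      by (simp add: emeasure_eq_measure ennreal_leI)
  qed
  also have "\<dots> = ennreal (exp (- a * (\<Sum>n\<in>J. l n - 2 * d)))"
    using J by (simp add: prod_ennreal exp_sum sum_distrib_left)
  finally show ?thesis .
qed

lemma exists_grid_point: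
  assumes "n > 0"
  shows "\<exists>i<n. dist x (to_circle (real i / real n)) < 1 / real n"
proof -
  define t where "t = frac (rep_circle x)"
  have t: "0 \<le> t" "t < 1" by (simp_all add: t_def frac_lt_1)
  have x: "x = to_circle t" by (simp add: t_def to_circle_frac to_circle_rep)
  define i where "i = nat \<lfloor>real n * t\<rfloor>"
  have i: "real i \<le> real n * t" "real n * t < real i + 1" using t by (simp_all add: i_def)
  have "real n * t < real n * 1" using t assms by (intro mult_strict_left_mono) auto
  then have "i < n" using i by linarith
  moreover have "t - real i / real n = (real n * t - real i) / real n"
    using assms by (simp add: diff_divide_distrib)
  moreover have "0 \<le> (real n * t - real i) / real n" "(real n * t - real i) / real n < 1 / real n"
    using i assms by (auto intro: divide_strict_right_mono)
  ultimately have "i < n" "\<bar>t - real i / real n\<bar> < 1 / real n" by simp_all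
  moreover from this(2) have "dist x (to_circle (real i / real n)) < 1 / real n"
    using dist_to_circle_le[of t "real i / real n"] by (simp add: x dist_real_def)
  ultimately show ?thesis by blast
qed

text \<open>A union bound over grid points of spacing \<open>1 / n\<close>: each neighbourhood is
  missed with probability at most \<open>C * n powr (- \<gamma>)\<close>, and there are at most
  \<open>n\<close> of them. The total \<open>C * n powr (1 - \<gamma>)\<close> tends to 0, so one
  sufficiently large \<open>n\<close> from the frequent ones is enough for each
  \<open>\<epsilon>\<close>.\<close>

lemma AE_covered_ball:
  fixes l :: "nat \<Rightarrow> real" and N :: nat
  assumes f: "prob_density f" and l: "arc_lengths l" and l0: "l \<longlonglongrightarrow> 0" and a: "0 \<le> a" and r: "0 < r"
    and ae: "AE x in circle_lebesgue. x \<in> ball c (2 * r) \<longrightarrow> a \<le> f x"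
    and \<gamma>: "\<gamma> > 1" and freq: "\<exists>\<^sub>F n in sequentially. \<gamma> * ln (real n) \<le> a * (\<Sum>k=1..n. l k)"
  shows "AE \<omega> in (\<Pi>\<^sub>M n\<in>UNIV. density_measure f). \<forall>x\<in>ball c r. \<exists>n\<ge>N. dist (\<omega> n) x < l n / 2"
proof (rule AE_I_small_events)
  fix \<epsilon> :: real assume \<epsilon>: "\<epsilon> > 0"
  let ?M = "\<Pi>\<^sub>M n\<in>(UNIV :: nat set). density_measure f"
  have "\<forall>\<^sub>F n in sequentially. l n < r" using l0 r by (rule order_tendstoD)
  then obtain N' where N': "\<And>n. n \<ge> N' \<Longrightarrow> l n < r" by (auto simp: eventually_at_top_linorder)
  define N1 where "N1 = max 1 (max N N')"
  \<comment> \<open>The sum makes up for the indices below \<open>N1\<close>; the term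
    \<open>2 * a\<close> pays for reducing at most \<open>n\<close> radii by \<open>1 / n\<close>
    each.\<close>
  define C where "C = exp (a * (\<Sum>k\<in>{1..<N1}. l k) + 2 * a)"
  have "(\<lambda>n. C * real n powr (1 - \<gamma>)) \<longlonglongrightarrow> C * 0"
    using \<gamma> by (intro tendsto_intros tendsto_neg_powr filterlim_real_sequentially) auto
  then have "\<forall>\<^sub>F n in sequentially. C * real n powr (1 - \<gamma>) < \<epsilon>"
    using \<epsilon> by (intro order_tendstoD) auto
  note frequently_eventually_conj[OF freq eventually_conj[OF eventually_ge_at_top[of N1] this]]
  then obtain n where n: "\<gamma> * ln (real n) \<le> a * (\<Sum>k=1..n. l k)" "N1 \<le> n"
      "C * real n powr (1 - \<gamma>) < \<epsilon>"
    by (auto dest: frequently_ex)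
  have n1: "n \<ge> 1" using n(2) by (simp add: N1_def)
  define g where "g i = to_circle (real i / real n)" for i
  define I where "I = {i. i < n \<and> dist c (g i) < r + 1 / real n}"
  define E where "E i = {\<omega> \<in> space ?M. \<forall>k\<in>{N1..n}. l k / 2 - 1 / real n \<le> dist (g i) (\<omega> k)}" for i
  have E_sets [measurable]: "E i \<in> sets ?M" for i unfolding E_def by measurable
  have E_le: "emeasure ?M (E i) \<le> ennreal (C * real n powr (- \<gamma>))" if i: "i \<in> I" for i
  proof -
    have "emeasure ?M (E i) \<le> ennreal (exp (- a * (\<Sum>k\<in>{N1..n}. l k - 2 * (1 / real n))))"
      unfolding E_def
    proof (rule miss_prob_le[OF f _ a ae])
      fix k assume k: "k \<in> {N1..n}"
      show "ball (g i) (l k / 2 - 1 / real n) \<subseteq> ball c (2 * r)"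
      proof
        \<comment> \<open>The offset \<open>1 / n\<close> of the grid point cancels against the
          reduced radius, which leaves \<open>r + l k / 2 < 2 * r\<close>.\<close>
        fix y assume "y \<in> ball (g i) (l k / 2 - 1 / real n)"
        moreover have "l k < r" using k by (intro N') (auto simp: N1_def)
        moreover have "dist c (g i) < r + 1 / real n" using i by (simp add: I_def)
        moreover have "dist c y \<le> dist c (g i) + dist (g i) y" by (rule dist_triangle)
        ultimately show "y \<in> ball c (2 * r)" using r by (simp add: mem_ball)
      qed
      show "l k \<le> 1" using l k by (auto simp: arc_lengths_def N1_def less_imp_le)
    qed auto
    also have "- a * (\<Sum>k\<in>{N1..n}. l k - 2 * (1 / real n)) \<le> a * (\<Sum>k\<in>{1..<N1}. l k) + 2 * a - \<gamma> * ln (real n)"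
    proof -
      have "{1..n} = {1..<N1} \<union> {N1..n}" using n(2) by (auto simp: N1_def)
      then have "(\<Sum>k=1..n. l k) = (\<Sum>k\<in>{1..<N1}. l k) + (\<Sum>k\<in>{N1..n}. l k)"
        by (simp only:) (rule sum.union_disjoint, auto)
      moreover have "(\<Sum>k\<in>{N1..n}. l k - 2 * (1 / real n)) \<ge> (\<Sum>k\<in>{N1..n}. l k) - 2"
      proof -
        have "real (card {N1..n}) * (2 * (1 / real n)) \<le> real n * (2 * (1 / real n))"
          using n1 by (intro mult_right_mono) (auto simp: N1_def)
        then show ?thesis using n1 by (simp add: sum_subtractf)
      qed
      then have "a * (\<Sum>k\<in>{N1..n}. l k - 2 * (1 / real n)) \<ge> a * ((\<Sum>k\<in>{N1..n}. l k) - 2)"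
        using a by (intro mult_left_mono) auto
      ultimately show ?thesis using n(1) by (simp add: algebra_simps)
    qed
    then have "ennreal (exp (- a * (\<Sum>k\<in>{N1..n}. l k - 2 * (1 / real n)))) \<le> ennreal (C * real n powr (- \<gamma>))"
      using n1 by (intro ennreal_leI) (simp add: C_def powr_def exp_diff exp_minus field_simps flip: exp_add exp_minus)
    finally show ?thesis .
  qed
  show "\<exists>E\<in>sets ?M. emeasure ?M E \<le> ennreal \<epsilon> \<and>
      {\<omega> \<in> space ?M. \<not> (\<forall>x\<in>ball c r. \<exists>n\<ge>N. dist (\<omega> n) x < l n / 2)} \<subseteq> E"
  proof (intro bexI conjI)
    have fin: "finite I" by (simp add: I_def)
    have "emeasure ?M (\<Union>i\<in>I. E i) \<le> (\<Sum>i\<in>I. emeasure ?M (E i))"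
      by (rule emeasure_subadditive_finite) (auto simp: fin)
    also have "\<dots> \<le> (\<Sum>i\<in>I. ennreal (C * real n powr (- \<gamma>)))" by (intro sum_mono E_le)
    also have "\<dots> = ennreal (real (card I) * (C * real n powr (- \<gamma>)))"
      by (simp add: ennreal_mult ennreal_of_nat_eq_real_of_nat C_def)
    also have "\<dots> \<le> ennreal \<epsilon>"
    proof (rule ennreal_leI)
      have "card I \<le> card {..<n}" by (intro card_mono) (auto simp: I_def)
      then have "real (card I) * (C * real n powr (- \<gamma>)) \<le> real n * (C * real n powr (- \<gamma>))"
        by (intro mult_right_mono) (auto simp: C_def)
      also have "\<dots> = C * real n powr (1 - \<gamma>)"
        using n1 by (simp add: powr_diff powr_minus field_simps)
      finally show "real (card I) * (C * real n powr (- \<gamma>)) \<le> \<epsilon>" using n(3) by linarith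
    qed
    finally show "emeasure ?M (\<Union>i\<in>I. E i) \<le> ennreal \<epsilon>" .
    show "{\<omega> \<in> space ?M. \<not> (\<forall>x\<in>ball c r. \<exists>n\<ge>N. dist (\<omega> n) x < l n / 2)} \<subseteq> (\<Union>i\<in>I. E i)"
    proof
      fix \<omega> assume "\<omega> \<in> {\<omega> \<in> space ?M. \<not> (\<forall>x\<in>ball c r. \<exists>n\<ge>N. dist (\<omega> n) x < l n / 2)}"
      then obtain x where \<omega>: "\<omega> \<in> space ?M" and x: "dist c x < r" "\<And>k. k \<ge> N \<Longrightarrow> l k / 2 \<le> dist (\<omega> k) x"
        by (auto simp: not_less)
      obtain i where i: "i < n" "dist x (g i) < 1 / real n"
        using exists_grid_point[of n x] n1 by (auto simp: g_def)
      have "i \<in> I"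
        using i x(1) dist_triangle[of c "g i" x] by (simp add: I_def)
      moreover have "\<omega> \<in> E i"
      proof -
        have "l k / 2 - 1 / real n \<le> dist (g i) (\<omega> k)" if "k \<in> {N1..n}" for k
        proof -
          have "l k / 2 \<le> dist (\<omega> k) x" using that by (intro x) (auto simp: N1_def)
          moreover have "dist (\<omega> k) x \<le> dist (g i) (\<omega> k) + dist x (g i)"
            by (metis add.commute dist_commute dist_triangle)
          ultimately show ?thesis using i by linarith
        qed
        with \<omega> show ?thesis by (simp add: E_def)
      qed
      ultimately show "\<omega> \<in> (\<Union>i\<in>I. E i)" by blast
    qed
  qed measurable
qed

lemma ln_le_sum_inverse:
  assumes "0 < N" "N \<le> n"
  shows "ln ((real n + 1) / real N) \<le> (\<Sum>k\<in>{N..n}. 1 / real k)"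
  using assms(2)
proof (induction n rule: dec_induct)
  case base
  show ?case using ln_add_one_self_le_self[of "1 / real N"] assms(1) by (simp add: add_divide_distrib)
next
  case (step n)
  have n: "real n > 0" using step assms(1) by simp
  have "(x + 1) / real N = x / real N * (1 + 1 / x)" if "x > 0" for x
    using assms(1) that by (simp add: field_simps)
  from this[of "real n + 1"]
  have "(real (Suc n) + 1) / real N = (real n + 1) / real N * (1 + 1 / real (Suc n))"
    by (simp add: add.commute)
  then have "ln ((real (Suc n) + 1) / real N) = ln ((real n + 1) / real N) + ln (1 + 1 / real (Suc n))"
    using assms(1) by (simp only:) (rule ln_mult_pos, auto intro: add_pos_pos)
  also have "\<dots> \<le> (\<Sum>k\<in>{N..n}. 1 / real k) + 1 / real (Suc n)"
    by (intro add_mono step ln_add_one_self_le_self) auto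
  finally show ?case using step by simp
qed

text \<open>Since \<open>m * l k > s / k\<close>, the arcs up to \<open>n\<close> contribute about
  \<open>s * ln n\<close> to the exponent. Taking \<open>n\<close> near \<open>1 / d\<close>, a
  piece of diameter \<open>d\<close> is missed with probability at most \<open>C * d powr s\<close>,
  and vanishing Hausdorff measure provides covers for which these bounds have an arbitrarily small
  sum.\<close>

lemma AE_covered_null_set:
  fixes l :: "nat \<Rightarrow> real" and N :: nat
  assumes f: "prob_density f" and l: "arc_lengths l" and m: "0 \<le> m"
    and ae: "AE x in circle_lebesgue. m \<le> f x"
    and s: "0 < s" and null: "hausdorff_measure s K = 0"
    and ev: "\<forall>\<^sub>F n in sequentially. s < m * real n * l n"
  shows "AE \<omega> in (\<Pi>\<^sub>M n\<in>UNIV. density_measure f). \<forall>x\<in>K. \<exists>n\<ge>N. dist (\<omega> n) x < l n / 2"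
proof (rule AE_I_small_events)
  fix \<epsilon> :: real assume \<epsilon>: "\<epsilon> > 0"
  let ?M = "\<Pi>\<^sub>M n\<in>(UNIV :: nat set). density_measure f"
  obtain N' where N': "\<And>n. n \<ge> N' \<Longrightarrow> s < m * real n * l n"
    using ev by (auto simp: eventually_at_top_linorder)
  define N1 where "N1 = max 1 (max N N')"
  have N1: "N1 \<ge> 1" by (simp add: N1_def)
  \<comment> \<open>\<open>exp (2 * m)\<close> pays for the slack, as
    \<open>n * d i \<le> 1\<close>; the power of \<open>N1\<close> arises because the harmonic sum
    starts at \<open>N1\<close>.\<close>
  define C where "C = exp (2 * m) * real N1 powr s"
  have C: "C > 0" using N1 by (simp add: C_def)
  \<comment> \<open>This mesh guarantees \<open>1 / d i \<ge> N1\<close>, so that the index chosen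
    for a piece of positive diameter is at least \<open>N1\<close>.\<close>
  define \<delta> where "\<delta> = 1 / real N1"
  have \<delta>: "\<delta> > 0" using N1 by (simp add: \<delta>_def)
  have "hausdorff_premeasure s \<delta> K \<le> hausdorff_measure s K"
    unfolding hausdorff_measure_def using \<delta> by (intro SUP_upper) simp
  then have "hausdorff_premeasure s \<delta> K < ennreal (\<epsilon> / C)" using null \<epsilon> C by simp
  then obtain U where U: "K \<subseteq> (\<Union>n. U n)" "\<And>n. bounded (U n)" "\<And>n. diameter (U n) \<le> \<delta>"
      "(\<Sum>n. ennreal (diameter (U n) powr s)) < ennreal (\<epsilon> / C)"
    unfolding hausdorff_premeasure_def INF_less_iff by auto
  define d where "d i = diameter (U i)" for i
  have d: "0 \<le> d i" for i by (simp add: d_def diameter_ge_0 U)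
  \<comment> \<open>For an empty piece \<open>c i\<close> is an arbitrary point; its diameter is 0
    and its event obeys the same bound.\<close>
  define c where "c i = (SOME x. x \<in> U i)" for i
  have c: "c i \<in> U i" if "U i \<noteq> {}" for i unfolding c_def using that by (simp add: some_in_eq)
  define E where "E i = {\<omega> \<in> space ?M. \<forall>k\<ge>N1. l k / 2 - d i \<le> dist (c i) (\<omega> k)}" for i
  have E_sets [measurable]: "E i \<in> sets ?M" for i unfolding E_def by measurable
  have E_n: "emeasure ?M (E i) \<le> ennreal (C * (1 / (real n + 1)) powr s)"
    if n: "n \<ge> N1" "real n * d i \<le> 1" for i n
  proof -
    have "emeasure ?M (E i) \<le> emeasure ?M {\<omega> \<in> space ?M. \<forall>k\<in>{N1..n}. l k / 2 - d i \<le> dist (c i) (\<omega> k)}"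
      by (rule emeasure_mono) (auto simp: E_def)
    also have "\<dots> \<le> ennreal (exp (- m * (\<Sum>k\<in>{N1..n}. l k - 2 * d i)))"
      using l N1 by (intro miss_prob_le[OF f _ m, where B=UNIV] d) (auto simp: ae arc_lengths_def less_imp_le)
    also have "\<dots> \<le> ennreal (C * (1 / (real n + 1)) powr s)"
    proof (rule ennreal_leI)
      have "s * ln ((real n + 1) / real N1) \<le> s * (\<Sum>k\<in>{N1..n}. 1 / real k)"
        using s N1 n by (intro mult_left_mono ln_le_sum_inverse) auto
      also have "\<dots> \<le> m * (\<Sum>k\<in>{N1..n}. l k)"
        unfolding sum_distrib_left
      proof (rule sum_mono)
        fix k assume k: "k \<in> {N1..n}"
        have "s < m * real k * l k" using k by (intro N') (auto simp: N1_def)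
        then show "s * (1 / real k) \<le> m * l k" using k N1 by (simp add: field_simps)
      qed
      finally have 1: "s * ln ((real n + 1) / real N1) \<le> m * (\<Sum>k\<in>{N1..n}. l k)" .
      have "real (card {N1..n}) * d i \<le> real n * d i"
        using N1 by (intro mult_right_mono d) auto
      then have "m * (real (card {N1..n}) * d i) \<le> m * 1" using n m by (intro mult_left_mono) auto
      then have "- m * (\<Sum>k\<in>{N1..n}. l k - 2 * d i) \<le> 2 * m - s * ln ((real n + 1) / real N1)"
        using 1 by (simp add: sum_subtractf algebra_simps)
      also have "\<dots> = 2 * m + s * ln (real N1) + s * ln (1 / (real n + 1))"
        using N1 by (simp add: ln_div algebra_simps)
      finally have "exp (- m * (\<Sum>k\<in>{N1..n}. l k - 2 * d i)) \<le> exp (2 * m + s * ln (real N1) + s * ln (1 / (real n + 1)))"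
        by simp
      also have "\<dots> = C * (1 / (real n + 1)) powr s"
        using N1 by (simp add: C_def powr_def exp_add)
      finally show "exp (- m * (\<Sum>k\<in>{N1..n}. l k - 2 * d i)) \<le> C * (1 / (real n + 1)) powr s" .
    qed
    finally show ?thesis .
  qed
  have E_le: "emeasure ?M (E i) \<le> ennreal (C * d i powr s)" for i
    \<comment> \<open>\<open>n\<close> is chosen near \<open>1 / d i\<close>; for \<open>d i = 0\<close> all \<open>n\<close> are allowed and the event is null.\<close>
  proof (cases "d i = 0")
    case True
    have "(\<lambda>n. 1 / (real n + 1)) \<longlonglongrightarrow> 0"
      using LIMSEQ_Suc[OF lim_1_over_n[where 'a=real]] by (simp add: add.commute)
    then have "(\<lambda>n. C * (1 / (real n + 1)) powr s) \<longlonglongrightarrow> C * 0 powr s"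
      using s by (intro tendsto_intros) auto
    then have "(\<lambda>n. ennreal (C * (1 / (real n + 1)) powr s)) \<longlonglongrightarrow> ennreal (C * 0 powr s)"
      by (rule tendsto_ennrealI)
    then show ?thesis
      unfolding True by (rule LIMSEQ_le_const) (use E_n[of _ i] True in auto)
  next
    case False
    with d[of i] have pos: "d i > 0" by simp
    define n where "n = nat \<lfloor>1 / d i\<rfloor>"
    have n: "real n \<le> 1 / d i" "1 / d i < real n + 1" using pos by (simp_all add: n_def)
    have "real N1 \<le> 1 / d i"
      using U(3)[of i] pos N1 by (simp add: \<delta>_def d_def field_simps)
    then have "N1 \<le> n" using n by linarith
    moreover have "real n * d i \<le> 1" using n pos by (simp add: field_simps)
    ultimately have "emeasure ?M (E i) \<le> ennreal (C * (1 / (real n + 1)) powr s)" by (rule E_n)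
    also have "\<dots> \<le> ennreal (C * d i powr s)"
      using n pos C s by (intro ennreal_leI mult_left_mono powr_mono2) (auto simp: field_simps)
    finally show ?thesis .
  qed
  show "\<exists>E\<in>sets ?M. emeasure ?M E \<le> ennreal \<epsilon> \<and>
      {\<omega> \<in> space ?M. \<not> (\<forall>x\<in>K. \<exists>n\<ge>N. dist (\<omega> n) x < l n / 2)} \<subseteq> E"
  proof (intro bexI conjI)
    have "emeasure ?M (\<Union>i. E i) \<le> (\<Sum>i. emeasure ?M (E i))"
      by (rule emeasure_subadditive_countably) auto
    also have "\<dots> \<le> (\<Sum>i. ennreal C * ennreal (d i powr s))"
      using E_le C by (intro suminf_le) (auto simp: ennreal_mult)
    also have "\<dots> = ennreal C * (\<Sum>i. ennreal (d i powr s))" by simp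
    also have "\<dots> \<le> ennreal C * ennreal (\<epsilon> / C)"
      using U(4) by (intro mult_left_mono) (auto simp: d_def)
    also have "\<dots> = ennreal \<epsilon>" using C \<epsilon> by (simp flip: ennreal_mult)
    finally show "emeasure ?M (\<Union>i. E i) \<le> ennreal \<epsilon>" .
    show "{\<omega> \<in> space ?M. \<not> (\<forall>x\<in>K. \<exists>n\<ge>N. dist (\<omega> n) x < l n / 2)} \<subseteq> (\<Union>i. E i)"
    proof
      fix \<omega> assume "\<omega> \<in> {\<omega> \<in> space ?M. \<not> (\<forall>x\<in>K. \<exists>n\<ge>N. dist (\<omega> n) x < l n / 2)}"
      then obtain x where \<omega>: "\<omega> \<in> space ?M" and x: "x \<in> K" "\<And>k. k \<ge> N \<Longrightarrow> l k / 2 \<le> dist (\<omega> k) x"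
        by (auto simp: not_less)
      obtain i where i: "x \<in> U i" using x(1) U(1) by blast
      have "\<omega> \<in> E i"
      proof -
        have "l k / 2 - d i \<le> dist (c i) (\<omega> k)" if "k \<ge> N1" for k
        proof -
          have "l k / 2 \<le> dist (\<omega> k) x" using that by (intro x) (auto simp: N1_def)
          moreover have "dist (\<omega> k) x \<le> dist (c i) (\<omega> k) + dist (c i) x" by (rule dist_triangle3)
          moreover have "dist (c i) x \<le> d i"
            unfolding d_def using i c by (intro diameter_bounded_bound U) auto
          ultimately show ?thesis by linarith
        qed
        with \<omega> show ?thesis by (simp add: E_def)
      qed
      then show "\<omega> \<in> (\<Union>i. E i)" by blast
    qed
  qed measurable
qed

section \<open>Essential infima and the complement of the minimum set\<close>

lemma prob_density_AE_nonneg: "prob_density f \<Longrightarrow> AE x in circle_lebesgue. 0 \<le> f x"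
  by (simp add: prob_density_def)

text \<open>If every natural number were a lower bound almost everywhere on \<open>J\<close>, then
  almost no point could lie in \<open>J\<close>, because \<open>f\<close> is real valued. This makes
  the real \<open>Sup\<close> behind \<open>ess_inf\<close> a true supremum.\<close>

lemma ess_inf_set_bdd_above:
  assumes "J \<in> sets borel" "emeasure circle_lebesgue J > 0"
  shows "bdd_above {a. AE x in circle_lebesgue. x \<in> J \<longrightarrow> f x \<ge> (a :: real)}"
proof (rule ccontr)
  assume nb: "\<not> ?thesis"
  have "AE x in circle_lebesgue. x \<in> J \<longrightarrow> f x \<ge> real n" for n
  proof -
    obtain a where a: "AE x in circle_lebesgue. x \<in> J \<longrightarrow> f x \<ge> a" "a > real n"
      using nb unfolding bdd_above_def by (auto simp: not_le)
    from a(1) show ?thesis by eventually_elim (use a(2) in auto)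
  qed
  then have "AE x in circle_lebesgue. \<forall>n. x \<in> J \<longrightarrow> f x \<ge> real n"
    unfolding AE_all_countable by blast
  then have "AE x in circle_lebesgue. x \<notin> J"
    by eventually_elim (meson not_le reals_Archimedean2)
  then have "emeasure circle_lebesgue J = 0"
    using assms(1) by (subst (asm) AE_iff_measurable[where N = J]) auto
  with assms(2) show False by simp
qed

lemma AE_ge_of_less_ess_inf:
  assumes f: "prob_density f" and J: "J \<in> sets borel" "emeasure circle_lebesgue J > 0" and a: "a < ess_inf J f"
  shows "AE x in circle_lebesgue. x \<in> J \<longrightarrow> a \<le> f x"
proof -
  let ?S = "{a. AE x in circle_lebesgue. x \<in> J \<longrightarrow> f x \<ge> a}"
  \<comment> \<open>Nonnegativity of the density makes the set of lower bounds nonempty.\<close>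
  have "0 \<in> ?S" using prob_density_AE_nonneg[OF f] by auto
  then have "?S \<noteq> {}" by blast
  then obtain b where b: "b \<in> ?S" "a < b"
    using a ess_inf_set_bdd_above[OF J] unfolding ess_inf_def by (auto simp: less_cSup_iff)
  from b(1) have "AE x in circle_lebesgue. x \<in> J \<longrightarrow> f x \<ge> b" by simp
  then show ?thesis by eventually_elim (use b(2) in auto)
qed

lemma le_ess_inf:
  assumes J: "J \<in> sets borel" "emeasure circle_lebesgue J > 0"
    and "AE x in circle_lebesgue. x \<in> J \<longrightarrow> a \<le> f x"
  shows "a \<le> ess_inf J f"
  unfolding ess_inf_def using assms by (intro cSup_upper ess_inf_set_bdd_above) auto

lemma circle_lebesgue_UNIV_pos: "emeasure circle_lebesgue UNIV > 0"
  using prob_space.emeasure_space_1[OF prob_space_circle_lebesgue] by simp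

text \<open>The supremum is attained: the bounds \<open>ess_min f - 1 / Suc n\<close> hold
  simultaneously off one null set and pass to the limit.\<close>

lemma AE_ge_ess_min:
  assumes f: "prob_density f"
  shows "AE x in circle_lebesgue. ess_min f \<le> f x"
proof -
  have "AE x in circle_lebesgue. \<forall>n. ess_min f - 1 / real (Suc n) \<le> f x"
    unfolding AE_all_countable
    using AE_ge_of_less_ess_inf[OF f, of UNIV] circle_lebesgue_UNIV_pos by auto
  then show ?thesis
  proof eventually_elim
    case (elim x)
    have "(\<lambda>n. ess_min f - 1 / real (Suc n)) \<longlonglongrightarrow> ess_min f - 0"
      by (intro tendsto_intros LIMSEQ_Suc[OF lim_1_over_n])
    then show ?case by (intro LIMSEQ_le_const2[of _ "ess_min f"]) (use elim in auto)
  qed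
qed

lemma emeasure_circle_ball_pos:
  assumes "0 < r"
  shows "emeasure circle_lebesgue (ball c r) > 0"
proof -
  have "0 < emeasure circle_lebesgue (ball c (min r (1 / 2)))"
    using assms by (simp add: emeasure_circle_ball)
  also have "\<dots> \<le> emeasure circle_lebesgue (ball c r)" by (rule emeasure_mono) auto
  finally show ?thesis .
qed

text \<open>The essential infimum over a ball is never below the global one, so if it fails to
  converge to it, it is strictly larger on some ball. Rational data leave countably many such balls,
  as needed for an almost sure statement about all \<open>x\<close> at once.\<close>

lemma outside_ess_min_set:
  assumes f: "prob_density f" and x: "x \<notin> ess_min_set f"
  obtains q r a where "q \<in> \<rat>" "r \<in> \<rat>" "a \<in> \<rat>" "0 < r" "ess_min f < a" "x \<in> ball (to_circle q) r"
    "AE y in circle_lebesgue. y \<in> ball (to_circle q) (2 * r) \<longrightarrow> a \<le> f y"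
proof -
  \<comment> \<open>Index 0 is excluded because \<open>1 / real 0\<close> is 0 and the ball is
    empty.\<close>
  have "\<exists>n\<ge>1. ess_min f < ess_inf (ball x (1 / real n)) f"
  proof (rule ccontr)
    assume "\<not> ?thesis"
    then have le: "ess_inf (ball x (1 / real n)) f \<le> ess_min f" if "n \<ge> 1" for n
      using that by (auto simp: not_less)
    have "ess_inf (ball x (1 / real n)) f = ess_min f" if n: "n \<ge> 1" for n
    proof (rule antisym[OF le[OF n]])
      show "ess_min f \<le> ess_inf (ball x (1 / real n)) f"
        using n AE_ge_ess_min[OF f] by (intro le_ess_inf emeasure_circle_ball_pos) auto
    qed
    then have "\<forall>\<^sub>F n in sequentially. ess_inf (ball x (1 / real n)) f = ess_min f"
      using eventually_ge_at_top[of 1] by (rule eventually_mono[rotated])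
    then have "(\<lambda>n. ess_inf (ball x (1 / real n)) f) \<longlonglongrightarrow> ess_min f" by (rule tendsto_eventually)
    with x show False by (simp add: ess_min_set_def)
  qed
  then obtain n where n: "n \<ge> 1" "ess_min f < ess_inf (ball x (1 / real n)) f" by blast
  obtain a where a: "a \<in> \<rat>" "ess_min f < a" "a < ess_inf (ball x (1 / real n)) f"
    using Rats_dense_in_real[OF n(2)] by auto
  have ae: "AE y in circle_lebesgue. y \<in> ball x (1 / real n) \<longrightarrow> a \<le> f y"
    using a n(1) by (intro AE_ge_of_less_ess_inf f emeasure_circle_ball_pos) auto
  \<comment> \<open>The centre \<open>q\<close> will be within \<open>r\<close> of \<open>x\<close>,
    so the ball of radius \<open>2 * r\<close> about it stays within \<open>3 * r < 1 / n\<close> of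
    \<open>x\<close>.\<close>
  obtain r where r: "r \<in> \<rat>" "0 < r" "r < 1 / (3 * real n)"
    using Rats_dense_in_real[of 0 "1 / (3 * real n)"] n(1) by auto
  obtain q where q: "q \<in> \<rat>" "rep_circle x < q" "q < rep_circle x + r"
    using Rats_dense_in_real[of "rep_circle x" "rep_circle x + r"] r by auto
  have dq: "dist (to_circle q) x < r"
    using dist_to_circle_le[of q "rep_circle x"] q by (simp add: to_circle_rep dist_real_def)
  show thesis
  proof
    show "x \<in> ball (to_circle q) r" using dq by simp
    have "3 * r < 1 / real n" using r n(1) by (simp add: field_simps)
    show "AE y in circle_lebesgue. y \<in> ball (to_circle q) (2 * r) \<longrightarrow> a \<le> f y"
      using ae
    proof eventually_elim
      case (elim y)
      have "dist x y \<le> dist (to_circle q) x + dist (to_circle q) y" by (rule dist_triangle3)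
      with dq \<open>3 * r < 1 / real n\<close> elim show ?case by auto
    qed
  qed (use q r a in auto)
qed

section \<open>Sufficiency of the sum condition\<close>

lemma limsup_le_of_not_frequently:
  fixes X :: "nat \<Rightarrow> real"
  assumes "\<not> (\<exists>\<^sub>F n in sequentially. y < X n)"
  shows "limsup (\<lambda>n. ereal (X n)) \<le> ereal y"
  using assms by (intro Limsup_bounded) (simp add: not_frequently not_less)

lemma arc_lengths_decay:
  assumes m: "0 < m" and l: "arc_lengths l"
    and lim: "limsup (\<lambda>n. ereal (m * real n * l n)) < \<infinity>"
  obtains B where "B > 0" "\<And>n. n \<ge> 1 \<Longrightarrow> l n \<le> B / real n" "l \<longlonglongrightarrow> 0"
proof -
  obtain b where b: "limsup (\<lambda>n. ereal (m * real n * l n)) < ereal b"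
    using lim less_PInf_Ex_of_nat by (metis less_irrefl)
  then have "\<forall>\<^sub>F n in sequentially. ereal (m * real n * l n) < ereal b" by (rule Limsup_lessD)
  then obtain N where N: "\<And>n. n \<ge> N \<Longrightarrow> m * real n * l n < b"
    by (auto simp: eventually_at_top_linorder)
  \<comment> \<open>The entry \<open>real N\<close> handles \<open>n < N\<close>, where only
    \<open>l n < 1\<close> is known; adding 1 makes \<open>B\<close> positive.\<close>
  define B where "B = max (\<bar>b\<bar> / m) (real N) + 1"
  have B: "l n \<le> B / real n" if n: "n \<ge> 1" for n
  proof (cases "n \<ge> N")
    case True
    have "real n * l n \<le> \<bar>b\<bar> / m" using N[OF True] m by (simp add: field_simps)
    then have "real n * l n \<le> B" by (simp add: B_def)
    then show ?thesis using n by (simp add: field_simps)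
  next
    case False
    have "l n \<le> 1" using l n by (simp add: arc_lengths_def less_imp_le)
    moreover have "real n \<le> B" using False by (simp add: B_def)
    ultimately have "real n * l n \<le> B * 1" using l n by (intro mult_mono) (auto simp: arc_lengths_def less_imp_le B_def)
    then show ?thesis using n by (simp add: field_simps)
  qed
  have "B > 0" using m by (simp add: B_def add_nonneg_pos le_max_iff_disj)
  moreover have "l \<longlonglongrightarrow> 0"
  proof (rule tendsto_sandwich)
    show "\<forall>\<^sub>F n in sequentially. 0 \<le> l n"
      using eventually_ge_at_top[of 1] by eventually_elim (use l in \<open>simp add: arc_lengths_def less_imp_le\<close>)
    show "\<forall>\<^sub>F n in sequentially. l n \<le> B / real n"
      using eventually_ge_at_top[of 1] by eventually_elim (rule B)
    show "(\<lambda>n. B / real n) \<longlonglongrightarrow> 0" by (rule lim_const_over_n)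
  qed auto
  ultimately show thesis using B that by blast
qed

text \<open>The minimum set is covered through an exponent \<open>s\<close> of vanishing Hausdorff
  measure, its complement through countably many rational balls on which \<open>f\<close> exceeds
  the minimum. Both hold for every starting index \<open>N\<close>, which gives infinitely many
  arcs.\<close>

lemma dvoretzky_covered_if:
  assumes f: "prob_density f" and l: "arc_lengths l" and m: "ess_min f > 0"
    and dim: "hausdorff_dim (ess_min_set f) < liminf (\<lambda>n. ereal (ess_min f * real n * l n))"
    and lim: "limsup (\<lambda>n. ereal (ess_min f * real n * l n)) < \<infinity>"
    and sums: "limsup (\<lambda>n. ereal ((\<Sum>k=1..n. l k) / ln (real n))) \<ge> ereal (1 / ess_min f)"
  shows "dvoretzky_covered f l"
proof -
  let ?M = "\<Pi>\<^sub>M n\<in>(UNIV :: nat set). density_measure f"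
  obtain B where l0: "l \<longlonglongrightarrow> 0" using arc_lengths_decay[OF m l lim] by blast
  \<comment> \<open>The dimension is an infimum of such exponents, so one of them lies strictly
    below the lower limit.\<close>
  obtain s where s: "0 < s" "hausdorff_measure s (ess_min_set f) = 0"
      "ereal s < liminf (\<lambda>n. ereal (ess_min f * real n * l n))"
    using dim unfolding hausdorff_dim_def INF_less_iff by auto
  have ev: "\<forall>\<^sub>F n in sequentially. s < ess_min f * real n * l n"
    using less_LiminfD[OF s(3)] by (simp only: less_ereal.simps)
  define T where "T = {(q, r, a). q \<in> \<rat> \<and> r \<in> \<rat> \<and> a \<in> \<rat> \<and> 0 < r \<and> ess_min f < a \<and>
    (AE y in circle_lebesgue. y \<in> ball (to_circle q) (2 * r) \<longrightarrow> a \<le> f y)}"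
  have "countable T"
    by (rule countable_subset[of _ "\<rat> \<times> \<rat> \<times> \<rat>"]) (auto simp: T_def countable_rat)
  have in1: "AE \<omega> in ?M. \<forall>x\<in>ess_min_set f. \<exists>n\<ge>N. dist (\<omega> n) x < l n / 2" for N
    by (rule AE_covered_null_set[OF f l less_imp_le[OF m] AE_ge_ess_min[OF f] s(1,2) ev])
  have in2: "AE \<omega> in ?M. \<forall>x\<in>ball (to_circle q) r. \<exists>n\<ge>N. dist (\<omega> n) x < l n / 2"
    if "(q, r, a) \<in> T" for N q r a
  proof (rule AE_covered_ball[OF f l l0])
    \<comment> \<open>The midpoint of 1 and \<open>a / ess_min f\<close>: it exceeds 1, while
      \<open>\<gamma> / a\<close> is still below \<open>1 / ess_min f\<close>.\<close>
    define \<gamma> where "\<gamma> = (1 + a / ess_min f) / 2"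
    have a: "ess_min f < a" "0 < a" using that m by (auto simp: T_def)
    show "\<gamma> > 1" using a m by (simp add: \<gamma>_def)
    have "\<gamma> / a < 1 / ess_min f" using a m unfolding \<gamma>_def by (simp add: divide_less_eq add_divide_distrib)
      (simp add: field_simps)
    have "\<exists>\<^sub>F n in sequentially. \<gamma> / a < (\<Sum>k=1..n. l k) / ln (real n)"
    proof (rule ccontr)
      assume "\<not> ?thesis"
      then have "limsup (\<lambda>n. ereal ((\<Sum>k=1..n. l k) / ln (real n))) \<le> ereal (\<gamma> / a)"
        by (rule limsup_le_of_not_frequently)
      with sums have "ereal (1 / ess_min f) \<le> ereal (\<gamma> / a)" by (rule order_trans)
      with \<open>\<gamma> / a < 1 / ess_min f\<close> show False by simp
    qed
    from frequently_eventually_conj[OF this eventually_ge_at_top[of 2]]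
    have "\<exists>\<^sub>F n in sequentially. 2 \<le> n \<and> \<gamma> / a < (\<Sum>k=1..n. l k) / ln (real n)" .
    then show "\<exists>\<^sub>F n in sequentially. \<gamma> * ln (real n) \<le> a * (\<Sum>k=1..n. l k)"
    proof (rule frequently_elim1)
      fix n assume n: "2 \<le> n \<and> \<gamma> / a < (\<Sum>k=1..n. l k) / ln (real n)"
      then have "ln (real n) > 0" by simp
      with n a show "\<gamma> * ln (real n) \<le> a * (\<Sum>k=1..n. l k)" by (simp add: field_simps)
    qed
  qed (use that m in \<open>auto simp: T_def\<close>)
  have "AE \<omega> in ?M. \<forall>N. \<forall>x\<in>ess_min_set f. \<exists>n\<ge>N. dist (\<omega> n) x < l n / 2"
    using in1 unfolding AE_all_countable by blast
  moreover have "AE \<omega> in ?M. \<forall>N. \<forall>z\<in>T. \<forall>x\<in>ball (to_circle (fst z)) (fst (snd z)). \<exists>n\<ge>N. dist (\<omega> n) x < l n / 2"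
    unfolding AE_all_countable AE_ball_countable[OF \<open>countable T\<close>]
  proof (intro allI ballI)
    fix N z assume "z \<in> T"
    then show "AE \<omega> in ?M. \<forall>x\<in>ball (to_circle (fst z)) (fst (snd z)). \<exists>n\<ge>N. dist (\<omega> n) x < l n / 2"
      using in2[of "fst z" "fst (snd z)" "snd (snd z)" N] by simp
  qed
  ultimately have "AE \<omega> in ?M. covers_circle l \<omega>"
  proof eventually_elim
    case (elim \<omega>)
    have "\<exists>n\<ge>N. dist (\<omega> n) x < l n / 2" for N x
    proof (cases "x \<in> ess_min_set f")
      case False
      obtain q r a where "q \<in> \<rat>" "r \<in> \<rat>" "a \<in> \<rat>" "0 < r" "ess_min f < a"
          and x: "x \<in> ball (to_circle q) r"
          and "AE y in circle_lebesgue. y \<in> ball (to_circle q) (2 * r) \<longrightarrow> a \<le> f y"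
        by (rule outside_ess_min_set[OF f False])
      then have "(q, r, a) \<in> T" by (simp add: T_def)
      from bspec[OF spec[OF elim(2), of N] this] x show ?thesis by simp
    qed (use elim(1) in blast)
    then have "\<exists>n\<ge>N. n \<ge> 1 \<and> x \<in> arc_at (\<omega> n) (l n)" for N x
    proof -
      obtain n where "n \<ge> max 1 N" "dist (\<omega> n) x < l n / 2"
        using \<open>\<And>x N. \<exists>n\<ge>N. dist (\<omega> n) x < l n / 2\<close> by blast
      then show ?thesis by (intro exI[of _ n]) (simp add: arc_at_eq_ball)
    qed
    then show ?case unfolding covers_circle_def infinite_nat_iff_unbounded_le by simp
  qed
  then show ?thesis unfolding dvoretzky_covered_def .
qed

section \<open>Upper density bounds on a set of positive measure\<close>

text \<open>Inside an open \<open>V\<close> containing \<open>E\<close>, Vitali's theorem selects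
  countably many disjoint balls of large ratio that cover \<open>E\<close> up to a null set; summing
  gives the bound with \<open>V\<close> on the right. Outer regularity of \<open>\<nu>\<close>
  replaces \<open>V\<close> by \<open>E\<close>.\<close>

lemma emeasure_ge_lborel_of_ball_ratio:
  fixes \<nu> :: "real measure" and c :: real
  assumes "finite_measure \<nu>" and sets_nu: "sets \<nu> = sets borel"
    and E: "E \<in> sets borel" and c: "0 \<le> c"
    and ratio: "\<And>x d. x \<in> E \<Longrightarrow> 0 < d \<Longrightarrow> \<exists>r. 0 < r \<and> r < d \<and> ennreal (c * (2 * r)) \<le> emeasure \<nu> (ball x r)"
  shows "ennreal c * emeasure lborel E \<le> emeasure \<nu> E"
proof -
  interpret finite_measure \<nu> by fact
  have "ennreal c * emeasure lborel E \<le> emeasure \<nu> V" if V: "open V" "E \<subseteq> V" for V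
  proof -
    define K where "K = {i :: real \<times> real. 0 < snd i \<and> ball (fst i) (snd i) \<subseteq> V \<and>
      ennreal (c * (2 * snd i)) \<le> emeasure \<nu> (ball (fst i) (snd i))}"
    have "\<exists>i. i \<in> K \<and> x \<in> ball (fst i) (snd i) \<and> snd i < d" if x: "x \<in> E" and d: "0 < d" for x d
    proof -
      obtain e where e: "0 < e" "ball x e \<subseteq> V" using V x by (meson openE subsetD)
      obtain r where "0 < r" "r < min d e" "ennreal (c * (2 * r)) \<le> emeasure \<nu> (ball x r)"
        using ratio[OF x, of "min d e"] d e by auto
      then show ?thesis using e by (intro exI[of _ "(x, r)"]) (auto simp: K_def)
    qed
    then obtain C where C: "countable C" "C \<subseteq> K"
       "pairwise (\<lambda>i j. disjnt (ball (fst i) (snd i)) (ball (fst j) (snd j))) C"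
       "negligible (E - (\<Union>i\<in>C. ball (fst i) (snd i)))"
      by (rule Vitali_covering_theorem_balls)
    define W where "W = (\<Union>i\<in>C. ball (fst i) (snd i))"
    have disj: "disjoint_family_on (\<lambda>i. ball (fst i) (snd i)) C"
      using C(3) by (auto simp: disjoint_family_on_def pairwise_def disjnt_def)
    have W: "W \<in> sets borel" unfolding W_def by (intro borel_open open_UN) auto
    have "emeasure lborel (E - W) = 0"
      using C(4) E W unfolding W_def[symmetric] negligible_iff_null_sets null_sets_def by simp
    have "emeasure lborel E \<le> emeasure lborel (W \<union> (E - W))" using E W by (intro emeasure_mono) auto
    also have "\<dots> \<le> emeasure lborel W + emeasure lborel (E - W)" using E W by (intro emeasure_subadditive) auto
    finally have "emeasure lborel E \<le> emeasure lborel W"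
      using \<open>emeasure lborel (E - W) = 0\<close> by simp
    then have "ennreal c * emeasure lborel E \<le> ennreal c * emeasure lborel W" by (intro mult_left_mono) auto
    also have "emeasure lborel W = (\<integral>\<^sup>+i. emeasure lborel (ball (fst i) (snd i)) \<partial>count_space C)"
      unfolding W_def by (intro emeasure_UN_countable C disj) auto
    also have "ennreal c * \<dots> = (\<integral>\<^sup>+i. ennreal c * emeasure lborel (ball (fst i) (snd i)) \<partial>count_space C)"
      by (simp add: nn_integral_cmult)
    also have "\<dots> \<le> (\<integral>\<^sup>+i. emeasure \<nu> (ball (fst i) (snd i)) \<partial>count_space C)"
    proof (rule nn_integral_mono)
      fix i assume "i \<in> space (count_space C)"
      then have i: "0 < snd i" "ennreal (c * (2 * snd i)) \<le> emeasure \<nu> (ball (fst i) (snd i))"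
        using C(2) by (auto simp: K_def)
      have "emeasure lborel (ball (fst i) (snd i)) = ennreal (2 * snd i)"
        using i(1) by (simp add: ball_eq_greaterThanLessThan)
      then have "ennreal c * emeasure lborel (ball (fst i) (snd i)) = ennreal (c * (2 * snd i))"
        using i(1) c by (simp add: ennreal_mult)
      with i(2) show "ennreal c * emeasure lborel (ball (fst i) (snd i)) \<le> emeasure \<nu> (ball (fst i) (snd i))"
        by simp
    qed
    also have "\<dots> = emeasure \<nu> W"
      unfolding W_def by (intro emeasure_UN_countable[symmetric] C disj) (auto simp: sets_nu)
    also have "\<dots> \<le> emeasure \<nu> V"
      using C(2) V by (intro emeasure_mono) (auto simp: W_def K_def sets_nu)
    finally show ?thesis .
  qed
  then have "ennreal c * emeasure lborel E \<le> (INF V\<in>{V. E \<subseteq> V \<and> open V}. emeasure \<nu> V)"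
    by (intro INF_greatest) auto
  also have "\<dots> = emeasure \<nu> E"
    using sets_nu E by (intro outer_regular[symmetric]) (auto simp: less_top)
  finally show ?thesis .
qed

lemma measurable_measure_ball:
  fixes \<mu> :: "circle measure"
  assumes "prob_space \<mu>" and [measurable_cong]: "sets \<mu> = sets borel"
  shows "(\<lambda>x. measure \<mu> (ball x r)) \<in> borel_measurable borel"
proof -
  interpret prob_space \<mu> by fact
  have "measure \<mu> (ball x r) = enn2real (\<integral>\<^sup>+w. (if dist x w < r then 1 else 0) \<partial>\<mu>)" for x
  proof -
    have "(\<integral>\<^sup>+w. (if dist x w < r then 1 else 0) \<partial>\<mu>) = (\<integral>\<^sup>+w. indicator (ball x r) w \<partial>\<mu>)"
      by (intro nn_integral_cong) (auto simp: indicator_def)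
    also have "\<dots> = emeasure \<mu> (ball x r)" using assms(2) by (intro nn_integral_indicator) auto
    finally show ?thesis by (simp add: measure_def)
  qed
  moreover have "(\<lambda>x. enn2real (\<integral>\<^sup>+w. (if dist x w < r then 1 else 0) \<partial>\<mu>)) \<in> borel_measurable borel"
    by measurable
  ultimately show ?thesis by simp
qed

lemma nn_integral_circle_lebesgue:
  assumes [measurable]: "g \<in> borel_measurable borel"
  shows "(\<integral>\<^sup>+x. g x \<partial>circle_lebesgue) = (\<integral>\<^sup>+t. g (to_circle t) * indicator {0..<1} t \<partial>lborel)"
proof -
  have t: "to_circle \<in> measurable (restrict_space lborel {0..<1}) borel"
    by (rule measurable_restrict_space1) simp
  show ?thesis
    unfolding circle_lebesgue_def
    by (subst nn_integral_distr[OF t]) (simp_all add: nn_integral_restrict_space)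
qed

text \<open>Transfers ball masses to the real line, where Vitali's theorem is applied. Since the
  lifted ball lies in the open unit interval, it does not wrap around.\<close>

lemma density_measure_ball_le_line:
  assumes f: "prob_density f" and sub: "ball s r \<subseteq> {0<..<1}" and r: "0 < r"
  shows "emeasure (density_measure f) (ball (to_circle s) r)
    \<le> (\<integral>\<^sup>+t. (ennreal (f (to_circle t)) * indicator {0<..<1} t) * indicator (ball s r) t \<partial>lborel)"
proof -
  note [measurable] = prob_density_borel[OF f]
  have [measurable]: "ball (to_circle s) r \<in> sets borel" by simp
  have "emeasure (density_measure f) (ball (to_circle s) r)
    = (\<integral>\<^sup>+x. ennreal (f x) * indicator (ball (to_circle s) r) x \<partial>circle_lebesgue)"
    using f by (intro emeasure_density_measure) auto
  also have "\<dots> = (\<integral>\<^sup>+t. ennreal (f (to_circle t)) * indicator (ball (to_circle s) r) (to_circle t) * indicator {0..<1} t \<partial>lborel)"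
    by (rule nn_integral_circle_lebesgue) measurable
  also have "\<dots> \<le> (\<integral>\<^sup>+t. (ennreal (f (to_circle t)) * indicator {0<..<1} t) * indicator (ball s r) t \<partial>lborel)"
  proof (rule nn_integral_mono)
    fix t
    have "t \<in> ball s r" if t: "0 \<le> t" "t < 1" and d: "dist (to_circle s) (to_circle t) < r"
    proof -
      define k where "k = round (s - t)"
      have "\<bar>s - t - of_int k\<bar> < r" using d by (simp add: dist_to_circle k_def)
      then have b: "t + of_int k \<in> ball s r" by (simp add: dist_real_def algebra_simps)
      then have "0 < t + of_int k" "t + of_int k < 1" using sub by auto
      \<comment> \<open>Two points of \<open>{0..<1}\<close> that differ by an integer
        coincide.\<close>
      with t have "k = 0" by linarith
      with b show ?thesis by simp
    qed
    moreover from this have "t \<in> {0<..<1}"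
      if "0 \<le> t" "t < 1" "dist (to_circle s) (to_circle t) < r" using that sub by blast
    ultimately show "ennreal (f (to_circle t)) * indicator (ball (to_circle s) r) (to_circle t) * indicator {0..<1} t
      \<le> (ennreal (f (to_circle t)) * indicator {0<..<1} t) * indicator (ball s r) t"
      by (cases "0 \<le> t \<and> t < 1 \<and> dist (to_circle s) (to_circle t) < r") (simp, force simp: indicator_def)
  qed
  finally show ?thesis .
qed

text \<open>Let \<open>E\<close> be the lift of the exceptional set to the open unit interval. Its
  points have arbitrarily small balls of ratio at least \<open>c\<close>, so its mass is at least
  \<open>c\<close> times its length; as \<open>f \<le> m\<close> there, it is also at most
  \<open>m\<close> times its length. As \<open>m < c\<close>, the length is 0.\<close>

lemma density_upper_bound_null:
  fixes l :: "nat \<Rightarrow> real"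
  assumes f: "prob_density f" and l: "arc_lengths l" and l0: "l \<longlonglongrightarrow> 0"
    and B [measurable]: "B \<in> sets borel" and fB: "\<And>x. x \<in> B \<Longrightarrow> f x \<le> m" and m: "0 \<le> m" "m < c"
  shows "emeasure circle_lebesgue
    {x \<in> B. \<forall>k. \<exists>n\<ge>k. c * l n < measure (density_measure f) (ball x (l n / 2))} = 0"
proof -
  interpret mu: prob_space "density_measure f" by (rule prob_space_density_measure[OF f])
  note [measurable] = prob_density_borel[OF f]
  have [measurable]: "(\<lambda>x. measure (density_measure f) (ball x r)) \<in> borel_measurable borel" for r
    by (rule measurable_measure_ball) (auto simp: mu.prob_space_axioms)
  define D where "D = {x \<in> B. \<forall>k. \<exists>n\<ge>k. c * l n < measure (density_measure f) (ball x (l n / 2))}"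
  have D_borel [measurable]: "D \<in> sets borel" unfolding D_def by measurable
  define E where "E = {0<..<1} \<inter> to_circle -` D"
  have E [measurable]: "E \<in> sets borel" unfolding E_def by measurable
  define \<nu> where "\<nu> = density lborel (\<lambda>t. ennreal (f (to_circle t)) * indicator {0<..<1} t)"
  have nu: "emeasure \<nu> S = (\<integral>\<^sup>+t. (ennreal (f (to_circle t)) * indicator {0<..<1} t) * indicator S t \<partial>lborel)"
    if "S \<in> sets borel" for S
    unfolding \<nu>_def using that by (intro emeasure_density) auto
  have fin: "finite_measure \<nu>"
  proof
    have "emeasure \<nu> (space \<nu>) = (\<integral>\<^sup>+t. (ennreal (f (to_circle t)) * indicator {0<..<1} t) * indicator UNIV t \<partial>lborel)"
      by (subst nu) (auto simp: \<nu>_def)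
    also have "\<dots> \<le> (\<integral>\<^sup>+t. ennreal (f (to_circle t)) * indicator {0..<1} t \<partial>lborel)"
      by (intro nn_integral_mono) (auto simp: indicator_def)
    also have "\<dots> = (\<integral>\<^sup>+x. ennreal (f x) * indicator UNIV x \<partial>circle_lebesgue)"
      by (subst nn_integral_circle_lebesgue) auto
    also have "\<dots> = emeasure (density_measure f) UNIV"
      using f by (simp add: emeasure_density_measure)
    also have "\<dots> = 1" using mu.emeasure_space_1 by simp
    finally show "emeasure \<nu> (space \<nu>) \<noteq> \<infinity>" by (auto simp: top_unique)
  qed
  have "ennreal c * emeasure lborel E \<le> emeasure \<nu> E"
  proof (rule emeasure_ge_lborel_of_ball_ratio[OF fin _ E])
    show "sets \<nu> = sets borel" by (simp add: \<nu>_def)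
    fix x d :: real assume x: "x \<in> E" and d: "0 < d"
    \<comment> \<open>The bounds by \<open>x\<close> and \<open>1 - x\<close> keep the ball inside
      the unit interval.\<close>
    have "\<forall>\<^sub>F n in sequentially. l n < min d (min x (1 - x))"
      using x d l0 by (intro order_tendstoD) (auto simp: E_def)
    then obtain k where k: "\<And>n. n \<ge> k \<Longrightarrow> l n < min d (min x (1 - x))"
      by (auto simp: eventually_at_top_linorder)
    obtain n where n: "n \<ge> max 1 k" "c * l n < measure (density_measure f) (ball (to_circle x) (l n / 2))"
      using x unfolding E_def D_def by blast
    have ln: "0 < l n" using l n by (auto simp: arc_lengths_def)
    have ln2: "l n < d" "l n < x" "l n < 1 - x" using k[of n] n by auto
    have "ball x (l n / 2) \<subseteq> {0<..<1}"
      using ln ln2 by (auto simp: dist_real_def abs_if split: if_splits)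
    then have "emeasure (density_measure f) (ball (to_circle x) (l n / 2)) \<le> emeasure \<nu> (ball x (l n / 2))"
      using ln by (subst nu) (auto intro!: density_measure_ball_le_line[OF f])
    moreover have "ennreal (c * (2 * (l n / 2))) \<le> emeasure (density_measure f) (ball (to_circle x) (l n / 2))"
      unfolding mu.emeasure_eq_measure using n by (intro ennreal_leI) simp
    ultimately show "\<exists>r. 0 < r \<and> r < d \<and> ennreal (c * (2 * r)) \<le> emeasure \<nu> (ball x r)"
      using ln ln2 by (intro exI[of _ "l n / 2"]) auto
  qed (use m in auto)
  also have "emeasure \<nu> E \<le> (\<integral>\<^sup>+t. ennreal m * indicator E t \<partial>lborel)"
    unfolding nu[OF E]
    by (intro nn_integral_mono) (auto simp: indicator_def E_def D_def intro!: ennreal_leI fB)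
  also have "\<dots> = ennreal m * emeasure lborel E" by (simp add: nn_integral_cmult)
  finally have le: "ennreal c * emeasure lborel E \<le> ennreal m * emeasure lborel E" .
  have "emeasure lborel E \<le> emeasure lborel {0<..<1::real}" by (rule emeasure_mono) (auto simp: E_def)
  then have "emeasure lborel E < \<infinity>" by (auto simp: top_unique less_top[symmetric])
  then obtain e where e: "emeasure lborel E = ennreal e" "0 \<le> e" by (cases "emeasure lborel E") auto
  have "c * e \<le> m * e" using le m e by (simp flip: ennreal_mult)
  then have "e = 0" using m e by (simp add: mult_le_cancel_right)
  have "emeasure circle_lebesgue D = emeasure lborel ({0..<0+1} \<inter> to_circle -` D)"
    by (rule emeasure_circle_lebesgue) measurable
  \<comment> \<open>The point 0 was lost on passing to the open interval.\<close>
  also have "\<dots> \<le> emeasure lborel ({0} \<union> E)" by (rule emeasure_mono) (auto simp: E_def)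
  also have "\<dots> \<le> emeasure lborel {0 :: real} + emeasure lborel E" by (rule emeasure_subadditive) auto
  also have "\<dots> = 0" using e \<open>e = 0\<close> by simp
  finally show ?thesis by (simp add: D_def)
qed

text \<open>For \<open>m\<close> strictly between the essential minimum and \<open>c\<close>, the
  set where \<open>f \<le> m\<close> has positive measure. Almost all of its points satisfy the ball
  bound from some index on, and by countable subadditivity one index \<open>k\<close> serves a set
  of positive measure.\<close>

lemma exists_set_with_ball_bound:
  fixes l :: "nat \<Rightarrow> real"
  assumes f: "prob_density f" and l: "arc_lengths l" and l0: "l \<longlonglongrightarrow> 0" and c: "0 \<le> ess_min f" "ess_min f < c"
  obtains A k where "A \<in> sets borel" "emeasure circle_lebesgue A > 0"
    "\<And>n x. n \<ge> k \<Longrightarrow> x \<in> A \<Longrightarrow> measure (density_measure f) (ball x (l n / 2)) \<le> c * l n"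
proof -
  interpret mu: prob_space "density_measure f" by (rule prob_space_density_measure[OF f])
  note [measurable] = prob_density_borel[OF f]
  have [measurable]: "(\<lambda>x. measure (density_measure f) (ball x r)) \<in> borel_measurable borel" for r
    by (rule measurable_measure_ball) (auto simp: mu.prob_space_axioms)
  obtain m where m: "ess_min f < m" "m < c" using dense[OF c(2)] by blast
  define B where "B = {x. f x \<le> m}"
  have B [measurable]: "B \<in> sets borel" unfolding B_def by measurable
  have B_pos: "emeasure circle_lebesgue B > 0"
  proof (rule ccontr)
    assume "\<not> ?thesis"
    then have "AE x in circle_lebesgue. x \<notin> B" by (intro AE_I[of _ _ B]) (auto simp: not_less)
    then have "AE x in circle_lebesgue. x \<in> UNIV \<longrightarrow> m \<le> f x"
      by eventually_elim (auto simp: B_def)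
    then have "m \<le> ess_min f" using circle_lebesgue_UNIV_pos by (intro le_ess_inf) auto
    with m show False by simp
  qed
  define A where "A k = {x \<in> B. \<forall>n\<ge>k. measure (density_measure f) (ball x (l n / 2)) \<le> c * l n}" for k
  have A [measurable]: "A k \<in> sets borel" for k unfolding A_def by measurable
  define D where "D = {x \<in> B. \<forall>k. \<exists>n\<ge>k. c * l n < measure (density_measure f) (ball x (l n / 2))}"
  have D [measurable]: "D \<in> sets borel" unfolding D_def by measurable
  have D0: "emeasure circle_lebesgue D = 0"
    unfolding D_def using m c by (intro density_upper_bound_null[OF f l l0]) (auto simp: B_def)
  have "\<exists>k. emeasure circle_lebesgue (A k) > 0"
  proof (rule ccontr)
    assume "\<not> ?thesis"
    then have U0: "emeasure circle_lebesgue (\<Union>k. A k) = 0"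
      by (intro emeasure_UN_eq_0) (auto simp: zero_less_iff_neq_zero)
    have "B \<subseteq> (\<Union>k. A k) \<union> D" unfolding A_def D_def not_le[symmetric] by blast
    then have "emeasure circle_lebesgue B \<le> emeasure circle_lebesgue ((\<Union>k. A k) \<union> D)"
      by (intro emeasure_mono) auto
    also have "\<dots> \<le> emeasure circle_lebesgue (\<Union>k. A k) + emeasure circle_lebesgue D"
      by (intro emeasure_subadditive) auto
    finally show False using U0 D0 B_pos by simp
  qed
  then obtain k where "emeasure circle_lebesgue (A k) > 0" by blast
  then show thesis by (intro that[of "A k" k] A) (auto simp: A_def)
qed

section \<open>Failure of covering when the sum condition fails\<close>

text \<open>The first bound keeps the linear coefficient exactly 1, which matters in the exponent of
  a long product; the second is crude and serves for a single factor.\<close>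

lemma div_square_one_minus_le:
  fixes p :: real
  assumes "0 \<le> p" "p \<le> 1 / 2"
  shows "p / (1 - p)\<^sup>2 \<le> p + 6 * p\<^sup>2" "p / (1 - p)\<^sup>2 \<le> 4 * p"
proof -
  have pos: "0 < (1 - p)\<^sup>2" using assms by simp
  have "(1 + 6 * p) * (1 - p)\<^sup>2 - 1 = p * (1 - 2 * p) * (4 - 3 * p) "
    by (simp add: power2_eq_square algebra_simps)
  moreover have "0 \<le> p * (1 - 2 * p) * (4 - 3 * p)" using assms by (intro mult_nonneg_nonneg) auto
  ultimately have "1 \<le> (1 + 6 * p) * (1 - p)\<^sup>2" by linarith
  then have "p * 1 \<le> p * ((1 + 6 * p) * (1 - p)\<^sup>2)" using assms by (intro mult_left_mono) auto
  then show le: "p / (1 - p)\<^sup>2 \<le> p + 6 * p\<^sup>2"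
    using pos by (simp add: pos_divide_le_eq power2_eq_square algebra_simps)
  have "p * p \<le> p * (1 / 2)" using assms by (intro mult_left_mono) auto
  then have "6 * p\<^sup>2 \<le> 3 * p" by (simp add: power2_eq_square)
  with le show "p / (1 - p)\<^sup>2 \<le> 4 * p" by linarith
qed

text \<open>Apply the second moment criterion with hitting bound \<open>c * l n\<close>. The excess
  of \<open>q n\<close> over \<open>c * l n\<close> is of order \<open>1 / n\<^sup>2\<close> and
  hence summable, so the product is at most a constant times the exponential of \<open>c\<close>
  times the partial sum.\<close>

lemma not_covered_if_summable:
  fixes l :: "nat \<Rightarrow> real"
  assumes f: "prob_density f" and l: "arc_lengths l" and l0: "l \<longlonglongrightarrow> 0"
    and B: "\<And>n. n \<ge> 1 \<Longrightarrow> l n \<le> B / real n" and c: "0 < c"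
    and A: "A \<in> sets borel" "emeasure circle_lebesgue A > 0"
    and ball_le: "\<And>n x. n \<ge> k \<Longrightarrow> x \<in> A \<Longrightarrow> measure (density_measure f) (ball x (l n / 2)) \<le> c * l n"
    and summ: "summable (\<lambda>n. exp (c * (\<Sum>j=1..n. l j)) / (real n)\<^sup>2)"
  shows "\<not> dvoretzky_covered f l"
proof -
  have lpos: "0 < l n" if "n \<ge> 1" for n using l that by (simp add: arc_lengths_def)
  have "B > 0" using B[of 1] lpos[of 1] by simp
  have "\<forall>\<^sub>F n in sequentially. l n < 1 / (2 * c)" using c by (intro order_tendstoD(2)[OF l0]) simp
  then obtain k' where k': "\<And>n. n \<ge> k' \<Longrightarrow> l n < 1 / (2 * c)" by (auto simp: eventually_at_top_linorder)
  define n0 where "n0 = max 1 (max k k')"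
  have n0: "n \<ge> 1" "n \<ge> k" "n \<ge> k'" if "n \<ge> n0" for n using that by (auto simp: n0_def)
  have p: "0 \<le> c * l n \<and> c * l n \<le> 1 / 2" if n: "n \<ge> n0" for n
    using k'[of n] lpos[of n] n0[OF n] c by (simp add: field_simps)
  define q where "q n = c * l n / (1 - c * l n)\<^sup>2" for n
  have q: "0 \<le> q n" "q n \<le> c * l n + 6 * (c * l n)\<^sup>2" "q n \<le> 4 * (c * l n)" if "n \<ge> n0" for n
    using p[OF that] div_square_one_minus_le[of "c * l n"] by (auto simp: q_def)
  have sq: "summable (\<lambda>n. 1 / (real n)\<^sup>2)"
    using inverse_power_summable[of 2, where 'a=real] by (simp add: field_simps)
  define Z where "Z = (\<Sum>n. 1 / (real n)\<^sup>2)"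
  define D where "D = exp (6 * c\<^sup>2 * B\<^sup>2 * Z)"
  have prod: "(\<Prod>j\<in>{n0..<n}. 1 + q j) \<le> D * exp (c * (\<Sum>j=1..n. l j))" for n
  proof -
    have 1: "(\<Prod>j\<in>{n0..<n}. 1 + q j) \<le> (\<Prod>j\<in>{n0..<n}. exp (q j))"
      using q by (intro prod_mono conjI exp_ge_add_one_self) (auto simp: add_nonneg_nonneg)
    have "(\<Sum>j\<in>{n0..<n}. q j) \<le> (\<Sum>j\<in>{n0..<n}. c * l j + 6 * c\<^sup>2 * B\<^sup>2 * (1 / (real j)\<^sup>2))"
    proof (rule sum_mono)
      fix j assume "j \<in> {n0..<n}"
      then have j: "j \<ge> n0" by simp
      have "(l j)\<^sup>2 \<le> (B / real j)\<^sup>2" using B[of j] lpos[of j] n0[OF j] by (intro power_mono) auto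
      then have "6 * c\<^sup>2 * (l j)\<^sup>2 \<le> 6 * c\<^sup>2 * (B / real j)\<^sup>2" by (intro mult_left_mono) auto
      then show "q j \<le> c * l j + 6 * c\<^sup>2 * B\<^sup>2 * (1 / (real j)\<^sup>2)"
        using q(2)[OF j] by (simp add: power_mult_distrib power_divide)
    qed
    also have "\<dots> = c * (\<Sum>j\<in>{n0..<n}. l j) + 6 * c\<^sup>2 * B\<^sup>2 * (\<Sum>j\<in>{n0..<n}. 1 / (real j)\<^sup>2)"
      by (simp add: sum.distrib sum_distrib_left)
    also have "\<dots> \<le> c * (\<Sum>j=1..n. l j) + 6 * c\<^sup>2 * B\<^sup>2 * Z"
    proof (rule add_mono; rule mult_left_mono)
      show "(\<Sum>j\<in>{n0..<n}. l j) \<le> (\<Sum>j=1..n. l j)"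
      proof (rule sum_mono2)
        show "{n0..<n} \<subseteq> {1..n}" by (auto simp: n0_def)
        show "0 \<le> l j" if "j \<in> {1..n} - {n0..<n}" for j using lpos[of j] that by simp
      qed simp
      show "(\<Sum>j\<in>{n0..<n}. 1 / (real j)\<^sup>2) \<le> Z"
        unfolding Z_def by (rule sum_le_suminf[OF sq]) auto
    qed (use c in auto)
    finally have "exp (\<Sum>j\<in>{n0..<n}. q j) \<le> exp (c * (\<Sum>j=1..n. l j) + 6 * c\<^sup>2 * B\<^sup>2 * Z)"
      by (rule exp_le_cancel_iff[THEN iffD2])
    also have "\<dots> = D * exp (c * (\<Sum>j=1..n. l j))" by (simp only: D_def exp_add mult.commute)
    finally show ?thesis using 1 by (simp add: exp_sum)
  qed
  \<comment> \<open>\<open>4 * c\<close> comes from the crude bound on \<open>q n\<close>,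
    \<open>B\<^sup>2\<close> from the two factors \<open>l n\<close>, and \<open>D\<close> from the
    product.\<close>
  define C where "C = 4 * c * B\<^sup>2 * D"
  have summand: "l n * q n * (\<Prod>j\<in>{n0..<n}. 1 + q j) \<le> C * (exp (c * (\<Sum>j=1..n. l j)) / (real n)\<^sup>2)"
    if n: "n \<ge> n0" for n
  proof -
    have "l n * q n \<le> l n * (4 * (c * l n))"
      using q(3)[OF n] lpos[of n] n0[OF n] by (intro mult_left_mono) auto
    also have "\<dots> = 4 * c * (l n)\<^sup>2" by (simp add: power2_eq_square)
    also have "\<dots> \<le> 4 * c * (B / real n)\<^sup>2"
      using B[of n] lpos[of n] n0[OF n] c by (intro mult_left_mono power_mono) auto
    finally have 1: "l n * q n \<le> 4 * c * (B / real n)\<^sup>2" .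
    have "l n * q n * (\<Prod>j\<in>{n0..<n}. 1 + q j) \<le> 4 * c * (B / real n)\<^sup>2 * (D * exp (c * (\<Sum>j=1..n. l j)))"
      using c q by (intro mult_mono 1 prod prod_nonneg) (auto simp: add_nonneg_nonneg)
    then show ?thesis by (simp add: C_def power_divide mult_ac)
  qed
  have C: "C \<ge> 0" using c by (simp add: C_def D_def)
  have "\<not> (AE \<omega> in (\<Pi>\<^sub>M n\<in>UNIV. density_measure f). covers_circle l \<omega>)"
  proof (rule not_covered_second_moment[where p="\<lambda>n. c * l n" and ?n0.0=n0 and A=A])
    fix N
    have "(\<Sum>n\<in>{n0..<N}. l n * q n * (\<Prod>j\<in>{n0..<n}. 1 + q j))
      \<le> (\<Sum>n\<in>{n0..<N}. C * (exp (c * (\<Sum>j=1..n. l j)) / (real n)\<^sup>2))"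
      by (intro sum_mono summand) auto
    also have "\<dots> \<le> (\<Sum>n. C * (exp (c * (\<Sum>j=1..n. l j)) / (real n)\<^sup>2))"
      using C by (intro sum_le_suminf summable_mult summ) auto
    finally show "(\<Sum>n\<in>{n0..<N}. l n * (c * l n / (1 - c * l n)\<^sup>2) * (\<Prod>k\<in>{n0..<n}. 1 + c * l k / (1 - c * l k)\<^sup>2))
      \<le> (\<Sum>n. C * (exp (c * (\<Sum>j=1..n. l j)) / (real n)\<^sup>2))"
      unfolding q_def .
  qed (use A ball_le n0 lpos p in \<open>auto simp: prob_space_density_measure[OF f] less_imp_le\<close>)
  then show ?thesis unfolding dvoretzky_covered_def .
qed

text \<open>If the upper limit is below \<open>y < 1 / ess_min f\<close>, there is a
  \<open>c > ess_min f\<close> with \<open>c * y < 1\<close>. Then the series of the second moment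
  criterion is eventually dominated by \<open>n powr (c * y - 2)\<close>, which is summable.\<close>

lemma dvoretzky_covered_only_if:
  assumes f: "prob_density f" and l: "arc_lengths l" and m: "ess_min f > 0"
    and lim: "limsup (\<lambda>n. ereal (ess_min f * real n * l n)) < \<infinity>"
    and cov: "dvoretzky_covered f l"
  shows "limsup (\<lambda>n. ereal ((\<Sum>k=1..n. l k) / ln (real n))) \<ge> ereal (1 / ess_min f)"
proof (rule ccontr)
  assume "\<not> ?thesis"
  \<comment> \<open>The maximum with 0 makes \<open>y\<close> positive, so that \<open>1 / y\<close>
    can bound \<open>c\<close>.\<close>
  then have "max 0 (limsup (\<lambda>n. ereal ((\<Sum>k=1..n. l k) / ln (real n)))) < ereal (1 / ess_min f)"
    using m by (simp add: not_le)
  then obtain y where y: "0 < ereal y" "limsup (\<lambda>n. ereal ((\<Sum>k=1..n. l k) / ln (real n))) < ereal y"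
      "ereal y < ereal (1 / ess_min f)"
    by (meson ereal_dense2 max_less_iff_conj)
  have y0: "0 < y" "ess_min f < 1 / y" using y(1,3) m by (simp_all add: field_simps)
  obtain c where c: "ess_min f < c" "c < 1 / y" using dense[OF y0(2)] by blast
  have cpos: "0 < c" using c m by simp
  obtain B where B: "B > 0" "\<And>n. n \<ge> 1 \<Longrightarrow> l n \<le> B / real n" and l0: "l \<longlonglongrightarrow> 0"
    by (rule arc_lengths_decay[OF m l lim], rule that)
  have "\<forall>\<^sub>F n in sequentially. (\<Sum>k=1..n. l k) / ln (real n) < y"
    using Limsup_lessD[OF y(2)] by simp
  then have "\<forall>\<^sub>F n in sequentially. norm (exp (c * (\<Sum>k=1..n. l k)) / (real n)\<^sup>2) \<le> real n powr (c * y - 2)"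
    using eventually_ge_at_top[of 2]
  proof eventually_elim
    case (elim n)
    have "ln (real n) > 0" using elim by simp
    with elim have "(\<Sum>k=1..n. l k) \<le> y * ln (real n)" by (simp add: divide_less_eq)
    then have "c * (\<Sum>k=1..n. l k) \<le> c * (y * ln (real n))" using cpos by (intro mult_left_mono) auto
    then have "exp (c * (\<Sum>k=1..n. l k)) \<le> real n powr (c * y)" using elim by (simp add: powr_def mult_ac)
    then have "exp (c * (\<Sum>k=1..n. l k)) / (real n)\<^sup>2 \<le> real n powr (c * y) / (real n)\<^sup>2"
      by (rule divide_right_mono) simp
    also have "\<dots> = real n powr (c * y - 2)"
      using elim by (simp add: powr_diff)
    finally show ?case by simp
  qed
  moreover have "summable (\<lambda>n. real n powr (c * y - 2))"
    using c(2) y0(1) by (simp add: summable_real_powr_iff field_simps)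
  ultimately have "summable (\<lambda>n. exp (c * (\<Sum>k=1..n. l k)) / (real n)\<^sup>2)"
    by (rule summable_comparison_test_ev)
  note * = not_covered_if_summable[OF f l l0 B(2) cpos _ _ _ this]
  show False
    by (rule exists_set_with_ball_bound[OF f l l0 less_imp_le[OF m] c(1)]) (use * cov in blast)
qed

section \<open>The uniform density\<close>

lemma bounded_circle: "bounded (S :: circle set)"
  using compact_imp_bounded[OF compact_UNIV_circle] by (rule bounded_subset) simp

text \<open>The circle is covered by \<open>n\<close> balls of diameter at most
  \<open>2 / n\<close>, with cost at most \<open>n * (2 / n) powr s\<close>, which tends to 0 for
  \<open>s > 1\<close>.\<close>

lemma hausdorff_measure_circle_eq_0:
  assumes s: "1 < s"
  shows "hausdorff_measure s (UNIV :: circle set) = 0"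
proof -
  have "hausdorff_premeasure s \<delta> (UNIV :: circle set) \<le> ennreal 0" if \<delta>: "\<delta> > 0" for \<delta>
  proof -
    have bnd: "hausdorff_premeasure s \<delta> (UNIV :: circle set) \<le> ennreal (2 powr s * real n powr (1 - s))"
      if n: "n \<ge> 1" "2 / real n \<le> \<delta>" for n
    proof -
      \<comment> \<open>Empty sets complete the sequence; they have diameter 0 and cost
        nothing.\<close>
      define U where "U i = (if i < n then ball (to_circle (real i / real n)) (1 / real n) else {})" for i
      have diam: "diameter (U i) \<le> 2 / real n" for i
      proof (cases "i < n")
        case True
        have "dist x y \<le> 2 * (1 / real n)" if "x \<in> U i" "y \<in> U i" for x y
        proof -
          from that have "dist (to_circle (real i / real n)) x < 1 / real n" "dist (to_circle (real i / real n)) y < 1 / real n"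
            using True by (auto simp: U_def)
          with dist_triangle3[of x y "to_circle (real i / real n)"] show ?thesis by linarith
        qed
        then show ?thesis by (auto simp: diameter_def intro!: cSUP_least)
      qed (simp add: U_def)
      have d0: "diameter (U i) \<ge> 0" for i by (intro diameter_ge_0 bounded_circle)
      have cover: "UNIV \<subseteq> (\<Union>i. U i)"
      proof
        fix x
        obtain i where "i < n" "dist x (to_circle (real i / real n)) < 1 / real n"
          using exists_grid_point[of n x] n by auto
        then show "x \<in> (\<Union>i. U i)" by (intro UN_I[of i]) (auto simp: U_def dist_commute)
      qed
      have "hausdorff_premeasure s \<delta> (UNIV :: circle set) \<le> (\<Sum>i. ennreal (diameter (U i) powr s))"
        unfolding hausdorff_premeasure_def
      proof (rule INF_lower)
        show "U \<in> {U. UNIV \<subseteq> (\<Union>n. U n) \<and> (\<forall>n. bounded (U n) \<and> diameter (U n) \<le> \<delta>)}"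
          using cover diam order_trans[OF diam n(2)] bounded_circle by blast
      qed
      also have "\<dots> = (\<Sum>i<n. ennreal (diameter (U i) powr s))"
        by (rule suminf_finite) (auto simp: U_def)
      also have "\<dots> \<le> (\<Sum>i<n. ennreal ((2 / real n) powr s))"
        using s d0 diam by (intro sum_mono ennreal_leI powr_mono2) auto
      also have "\<dots> = ennreal (real n * (2 / real n) powr s)"
        by (simp add: ennreal_mult ennreal_of_nat_eq_real_of_nat)
      also have "real n * (2 / real n) powr s = 2 powr s * real n powr (1 - s)"
        using n by (simp add: powr_divide powr_diff)
      finally show ?thesis .
    qed
    have "\<forall>\<^sub>F n in sequentially. 2 / real n \<le> \<delta>"
    proof -
      have "(\<lambda>n. 2 / real n) \<longlonglongrightarrow> 0" by (rule lim_const_over_n)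
      then have "\<forall>\<^sub>F n in sequentially. 2 / real n < \<delta>" using \<delta> by (rule order_tendstoD)
      then show ?thesis by eventually_elim simp
    qed
    then have "\<forall>\<^sub>F n in sequentially. hausdorff_premeasure s \<delta> (UNIV :: circle set) \<le> ennreal (2 powr s * real n powr (1 - s))"
      using eventually_ge_at_top[of 1] by eventually_elim (rule bnd)
    moreover have "(\<lambda>n. 2 powr s * real n powr (1 - s)) \<longlonglongrightarrow> 2 powr s * 0"
      using s by (intro tendsto_intros tendsto_neg_powr filterlim_real_sequentially) auto
    then have "(\<lambda>n. ennreal (2 powr s * real n powr (1 - s))) \<longlonglongrightarrow> ennreal 0"
      by (intro tendsto_ennrealI) simp
    ultimately show ?thesis by (intro tendsto_lowerbound[of _ "ennreal 0"]) auto
  qed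
  then have "hausdorff_measure s (UNIV :: circle set) \<le> 0"
    unfolding hausdorff_measure_def by (intro SUP_least) auto
  then show ?thesis by simp
qed

text \<open>The closed ball about any point of \<open>S\<close> with radius
  \<open>diameter S\<close> contains \<open>S\<close>; unlike \<open>S\<close>, it is known to be
  measurable.\<close>

lemma emeasure_circle_le_diameter:
  assumes "S \<noteq> {}"
  obtains T where "S \<subseteq> T" "T \<in> sets borel" "emeasure circle_lebesgue T \<le> ennreal (2 * diameter S)"
proof -
  obtain c where c: "c \<in> S" using assms by blast
  have d0: "diameter S \<ge> 0" by (intro diameter_ge_0 bounded_circle)
  show thesis
  proof
    show "S \<subseteq> cball c (diameter S)"
      using c by (auto intro!: diameter_bounded_bound bounded_circle)
    have "emeasure circle_lebesgue (cball c (diameter S)) \<le> ennreal (2 * (diameter S + 1 / real (Suc n)))" for n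
    proof -
      have "emeasure circle_lebesgue (cball c (diameter S)) \<le> emeasure circle_lebesgue (ball c (diameter S + 1 / real (Suc n)))"
      proof (rule emeasure_mono)
        have pos: "(0 :: real) < 1 / real (Suc n)" by simp
        show "cball c (diameter S) \<subseteq> ball c (diameter S + 1 / real (Suc n))"
        proof
          fix y assume "y \<in> cball c (diameter S)"
          then have "dist c y \<le> diameter S" by simp
          with pos show "y \<in> ball c (diameter S + 1 / real (Suc n))" unfolding mem_ball by linarith
        qed
      qed simp
      also have "\<dots> \<le> ennreal (2 * (diameter S + 1 / real (Suc n)))"
        using d0 by (intro emeasure_circle_ball_le) auto
      finally show ?thesis .
    qed
    moreover have "(\<lambda>n. ennreal (2 * (diameter S + 1 / real (Suc n)))) \<longlonglongrightarrow> ennreal (2 * (diameter S + 0))"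
      by (intro tendsto_ennrealI tendsto_intros LIMSEQ_Suc[OF lim_1_over_n])
    ultimately show "emeasure circle_lebesgue (cball c (diameter S)) \<le> ennreal (2 * diameter S)"
      by (intro LIMSEQ_le_const) auto
  qed simp
qed

text \<open>Mass distribution: a piece of diameter \<open>d \<le> 1\<close> has outer measure at
  most \<open>2 * d \<le> 2 * d powr s\<close>, so the costs of a cover sum to at least
  \<open>1 / 2\<close>. The threshold \<open>1 / 4\<close> contradicts this.\<close>

lemma hausdorff_measure_circle_pos:
  assumes s: "0 < s" "s \<le> 1"
  shows "hausdorff_measure s (UNIV :: circle set) \<noteq> 0"
proof
  assume null: "hausdorff_measure s (UNIV :: circle set) = 0"
  have "hausdorff_premeasure s 1 (UNIV :: circle set) \<le> hausdorff_measure s (UNIV :: circle set)"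
    unfolding hausdorff_measure_def by (intro SUP_upper) simp
  then have "hausdorff_premeasure s 1 (UNIV :: circle set) < ennreal (1 / 4)" using null by simp
  then obtain U :: "nat \<Rightarrow> circle set" where U: "UNIV \<subseteq> (\<Union>n. U n)" "\<And>n. diameter (U n) \<le> 1"
      "(\<Sum>n. ennreal (diameter (U n) powr s)) < ennreal (1 / 4)"
    unfolding hausdorff_premeasure_def INF_less_iff by auto
  have "\<exists>T. U n \<subseteq> T \<and> T \<in> sets borel \<and> emeasure circle_lebesgue T \<le> ennreal 2 * ennreal (diameter (U n) powr s)" for n
  proof (cases "U n = {}")
    case False
    have d0: "diameter (U n) \<ge> 0" by (intro diameter_ge_0 bounded_circle)
    have "diameter (U n) \<le> diameter (U n) powr s"
    proof (cases "diameter (U n) = 0")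
      case False
      then have "diameter (U n) powr 1 \<le> diameter (U n) powr s"
        using d0 U(2)[of n] s by (intro powr_mono') auto
      then show ?thesis using False d0 by simp
    qed simp
    then have "ennreal (2 * diameter (U n)) \<le> ennreal 2 * ennreal (diameter (U n) powr s)"
      by (subst ennreal_mult[symmetric]) (auto intro!: ennreal_leI)
    then show ?thesis using emeasure_circle_le_diameter[OF False] by (metis order_trans)
  qed (auto intro: exI[of _ "{}"])
  then obtain T where T: "\<And>n. U n \<subseteq> T n" "\<And>n. T n \<in> sets borel"
      "\<And>n. emeasure circle_lebesgue (T n) \<le> ennreal 2 * ennreal (diameter (U n) powr s)"
    by metis
  have "1 = emeasure circle_lebesgue UNIV"
    using prob_space.emeasure_space_1[OF prob_space_circle_lebesgue] by simp
  also have "\<dots> \<le> emeasure circle_lebesgue (\<Union>n. T n)"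
    using U(1) T(1,2) by (intro emeasure_mono) (auto, blast)
  also have "\<dots> \<le> (\<Sum>n. emeasure circle_lebesgue (T n))"
    using T(2) by (intro emeasure_subadditive_countably) auto
  also have "\<dots> \<le> (\<Sum>n. ennreal 2 * ennreal (diameter (U n) powr s))"
    using T(3) by (intro suminf_le) auto
  also have "\<dots> = ennreal 2 * (\<Sum>n. ennreal (diameter (U n) powr s))" by simp
  also have "\<dots> \<le> ennreal 2 * ennreal (1 / 4)" using U(3) by (intro mult_left_mono) auto
  also have "\<dots> = ennreal (1 / 2)" by (subst ennreal_mult[symmetric]) auto
  finally have "ennreal 1 \<le> ennreal (1 / 2)" by simp
  then show False by (subst (asm) ennreal_le_iff) auto
qed

lemma hausdorff_dim_circle: "hausdorff_dim (UNIV :: circle set) = 1"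
proof (rule antisym)
  show "1 \<le> hausdorff_dim (UNIV :: circle set)"
    unfolding hausdorff_dim_def
  proof (rule INF_greatest)
    fix s assume "s \<in> {s. 0 < s \<and> hausdorff_measure s (UNIV :: circle set) = 0}"
    then have "\<not> s \<le> 1" using hausdorff_measure_circle_pos by blast
    then show "1 \<le> ereal s" by simp
  qed
  show "hausdorff_dim (UNIV :: circle set) \<le> 1"
  proof (rule ereal_le_epsilon2)
    fix e :: real assume "0 < e"
    then have "hausdorff_dim (UNIV :: circle set) \<le> ereal (1 + e)"
      unfolding hausdorff_dim_def by (intro INF_lower) (auto intro: hausdorff_measure_circle_eq_0)
    then show "hausdorff_dim (UNIV :: circle set) \<le> 1 + ereal e" by (simp add: one_ereal_def)
  qed
qed

section \<open>Essential minimum and ball masses of a constant density\<close>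

lemma prob_density_const_1: "prob_density (\<lambda>_. 1)"
proof -
  interpret prob_space circle_lebesgue by (rule prob_space_circle_lebesgue)
  show ?thesis using prob_space by (simp add: prob_density_def)
qed

lemma ess_inf_const:
  assumes "J \<in> sets borel" "emeasure circle_lebesgue J > 0"
  shows "ess_inf J (\<lambda>_. c) = c"
proof (rule antisym)
  show "c \<le> ess_inf J (\<lambda>_. c)" by (rule le_ess_inf[OF assms]) simp
  have "a \<le> c" if a: "AE x in circle_lebesgue. x \<in> J \<longrightarrow> c \<ge> a" for a
  proof (rule ccontr)
    assume "\<not> a \<le> c"
    with a have "AE x in circle_lebesgue. x \<notin> J" by simp
    then have "emeasure circle_lebesgue J = 0"
      using assms(1) by (subst (asm) AE_iff_measurable[where N = J]) auto
    with assms(2) show False by simp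
  qed
  then show "ess_inf J (\<lambda>_. c) \<le> c"
    unfolding ess_inf_def by (intro cSup_least) auto
qed

lemma ess_min_const: "ess_min (\<lambda>_. c) = c"
  by (rule ess_inf_const) (simp_all add: circle_lebesgue_UNIV_pos)

lemma ess_min_set_const: "ess_min_set (\<lambda>_. c) = UNIV"
proof -
  have "(\<lambda>n. ess_inf (ball x (1 / real n)) (\<lambda>_. c)) \<longlonglongrightarrow> c" for x
  proof (rule tendsto_eventually)
    show "\<forall>\<^sub>F n in sequentially. ess_inf (ball x (1 / real n)) (\<lambda>_. c) = c"
      using eventually_ge_at_top[of 1]
      by eventually_elim (rule ess_inf_const, auto intro!: emeasure_circle_ball_pos)
  qed
  then show ?thesis by (simp add: ess_min_set_def ess_min_const)
qed

lemma measure_density_const_1_ball_le: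
  assumes "0 \<le> r"
  shows "measure (density_measure (\<lambda>_. 1)) (ball x r) \<le> 2 * r"
proof -
  have "emeasure (density_measure (\<lambda>_. 1)) (ball x r) = emeasure circle_lebesgue (ball x r)"
    by (simp add: emeasure_density_measure[OF prob_density_const_1])
  also have "\<dots> \<le> ennreal (2 * r)" by (rule emeasure_circle_ball_le[OF assms])
  finally show ?thesis using assms by (simp add: measure_def enn2real_leI)
qed

section \<open>The critical lengths\<close>

lemma inverse_le_ln_diff:
  fixes x :: real
  assumes "1 < x"
  shows "1 / x \<le> ln x - ln (x - 1)"
proof -
  have "ln ((x - 1) / x) \<le> (x - 1) / x - 1" using assms by (intro ln_le_minus_one) auto
  moreover have "ln ((x - 1) / x) = ln (x - 1) - ln x" using assms by (subst ln_div) auto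
  moreover have "(x - 1) / x - 1 = - (1 / x)" using assms by (simp add: field_simps)
  ultimately show ?thesis by linarith
qed

lemma sum_inverse_le_ln:
  assumes "2 \<le> N" "N \<le> n"
  shows "(\<Sum>k\<in>{N..n}. 1 / real k) \<le> ln (real n) - ln (real N - 1)"
  using assms(2)
proof (induction n rule: dec_induct)
  case base
  show ?case using inverse_le_ln_diff[of "real N"] assms(1) by simp
next
  case (step n)
  have "1 / real (Suc n) \<le> ln (real (Suc n)) - ln (real n)"
    using inverse_le_ln_diff[of "real (Suc n)"] step assms(1) by simp
  then show ?case using step by (simp del: of_nat_Suc)
qed

text \<open>A discrete form of the fact that \<open>ln (ln x)\<close> has derivative
  \<open>1 / (x * ln x)\<close>: the inequality \<open>ln u \<le> u - 1\<close> is applied to the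
  quotient of the logarithms and then to the quotient of the integers.\<close>

lemma ln_ln_diff_le:
  assumes "2 \<le> k"
  shows "ln (ln (real (Suc k))) - ln (ln (real k)) \<le> 1 / (real k * ln (real k))"
proof -
  have L: "ln (real k) > 0" "ln (real (Suc k)) > 0" using assms by simp_all
  have "ln (ln (real (Suc k)) / ln (real k)) \<le> ln (real (Suc k)) / ln (real k) - 1"
    using L by (intro ln_le_minus_one divide_pos_pos)
  also have "\<dots> = (ln (real (Suc k)) - ln (real k)) / ln (real k)"
    using L by (simp add: diff_divide_distrib)
  also have "ln (real (Suc k)) - ln (real k) = ln (real (Suc k) / real k)"
    using assms by (subst ln_div) auto
  also have "\<dots> \<le> real (Suc k) / real k - 1"
    using assms by (intro ln_le_minus_one) auto
  also have "real (Suc k) / real k - 1 = 1 / real k" using assms by (simp add: field_simps)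
  finally have "ln (ln (real (Suc k)) / ln (real k)) \<le> (1 / real k) / ln (real k)"
    using L by (simp add: divide_right_mono)
  then show ?thesis using L by (simp add: ln_div)
qed

text \<open>The matching bound from the left neighbour; \<open>k \<ge> 3\<close> makes
  \<open>ln (k - 1)\<close> positive.\<close>

lemma ln_ln_diff_ge:
  assumes "3 \<le> k"
  shows "1 / (real k * ln (real k)) \<le> ln (ln (real k)) - ln (ln (real k - 1))"
proof -
  have L: "ln (real k) > 0" "ln (real k - 1) > 0" using assms by simp_all
  have "1 / real k \<le> ln (real k) - ln (real k - 1)"
    using assms by (intro inverse_le_ln_diff) auto
  then have "(1 / real k) / ln (real k) \<le> (ln (real k) - ln (real k - 1)) / ln (real k)"
    using L by (intro divide_right_mono) auto
  also have "\<dots> = 1 - ln (real k - 1) / ln (real k)" using L by (simp add: diff_divide_distrib)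
  also have "\<dots> \<le> - ln (ln (real k - 1) / ln (real k))"
    using ln_le_minus_one[of "ln (real k - 1) / ln (real k)"] L by simp
  also have "\<dots> = ln (ln (real k)) - ln (ln (real k - 1))" using L by (simp add: ln_div)
  finally show ?thesis by simp
qed

lemma sum_inverse_ln_ge:
  assumes "2 \<le> N" "N \<le> n"
  shows "ln (ln (real (Suc n))) - ln (ln (real N)) \<le> (\<Sum>k\<in>{N..n}. 1 / (real k * ln (real k)))"
  using assms(2)
proof (induction n rule: dec_induct)
  case base
  show ?case using ln_ln_diff_le[OF assms(1)] by simp
next
  case (step n)
  have "ln (ln (real (Suc (Suc n)))) - ln (ln (real (Suc n))) \<le> 1 / (real (Suc n) * ln (real (Suc n)))"
    using step assms(1) by (intro ln_ln_diff_le) auto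
  then show ?case using step by (simp del: of_nat_Suc)
qed

lemma sum_inverse_ln_le:
  assumes "3 \<le> N" "N \<le> n"
  shows "(\<Sum>k\<in>{N..n}. 1 / (real k * ln (real k))) \<le> ln (ln (real n)) - ln (ln (real N - 1))"
  using assms(2)
proof (induction n rule: dec_induct)
  case base
  show ?case using ln_ln_diff_ge[OF assms(1)] by simp
next
  case (step n)
  have "1 / (real (Suc n) * ln (real (Suc n))) \<le> ln (ln (real (Suc n))) - ln (ln (real n))"
    using ln_ln_diff_ge[of "Suc n"] step assms(1) by simp
  then show ?case using step by (simp del: of_nat_Suc)
qed

text \<open>Comparison with the telescoping series of the differences of \<open>1 / ln n\<close>.
  The shift by 3 stays clear of \<open>ln 1 = 0\<close>.\<close>

lemma summable_inverse_ln_square: "summable (\<lambda>n. 1 / (real n * (ln (real n))\<^sup>2))"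
proof -
  let ?h = "\<lambda>n. 1 / ln (real (Suc n))"
  have "?h \<longlonglongrightarrow> 0" by real_asymp
  then have "summable (\<lambda>n. ?h n - ?h (Suc n))" by (rule telescope_summable')
  then have summ: "summable (\<lambda>n. ?h (n + 1) - ?h (Suc (n + 1)))"
    by (subst summable_iff_shift)
  have bnd: "norm (1 / (real (n + 3) * (ln (real (n + 3)))\<^sup>2)) \<le> ?h (n + 1) - ?h (Suc (n + 1))" for n
  proof -
    define a where "a = ln (real (n + 2))"
    define b where "b = ln (real (n + 3))"
    have ab: "0 < a" "a \<le> b" by (simp_all add: a_def b_def)
    have ba: "1 / real (n + 3) \<le> b - a"
      using inverse_le_ln_diff[of "real (n + 3)"] by (simp add: a_def b_def)
    have "1 / (real (n + 3) * b\<^sup>2) = (1 / real (n + 3)) / (b * b)" by (simp add: power2_eq_square)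
    also have "\<dots> \<le> (b - a) / (a * b)" using ab ba by (intro frac_le mult_right_mono) auto
    also have "\<dots> = 1 / a - 1 / b" using ab by (simp add: field_simps)
    finally show ?thesis by (simp add: a_def b_def add.commute)
  qed
  have "summable (\<lambda>n. 1 / (real (n + 3) * (ln (real (n + 3)))\<^sup>2))"
    by (rule summable_comparison_test'[OF summ, of 0]) (rule bnd)
  then show ?thesis
    by (rule summable_iff_shift[of "\<lambda>n. 1 / (real n * (ln (real n))\<^sup>2)" 3, THEN iffD1])
qed

section \<open>The lengths for essential minimum 1 and their partial sums\<close>

definition critical_length :: "real \<Rightarrow> nat \<Rightarrow> real"
  where "critical_length \<beta> n = 1 / real n - (1 + \<beta>) / (real n * ln (real n))"

lemma exists_arc_lengths_critical:
  "\<exists>l. arc_lengths l \<and> (\<forall>\<^sub>F n in sequentially. l n = critical_length \<beta> n)"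
proof -
  have "\<forall>\<^sub>F n in sequentially. critical_length \<beta> (Suc n) \<le> critical_length \<beta> n"
    unfolding critical_length_def by real_asymp
  moreover have "\<forall>\<^sub>F n in sequentially. 0 < critical_length \<beta> n"
    unfolding critical_length_def by real_asymp
  moreover have "\<forall>\<^sub>F n in sequentially. critical_length \<beta> n < 1"
    unfolding critical_length_def by real_asymp
  ultimately have "\<forall>\<^sub>F n in sequentially. critical_length \<beta> (Suc n) \<le> critical_length \<beta> n \<and>
      0 < critical_length \<beta> n \<and> critical_length \<beta> n < 1"
    by eventually_elim auto
  then obtain N where N: "\<And>n. n \<ge> N \<Longrightarrow> critical_length \<beta> (Suc n) \<le> critical_length \<beta> n \<and>
      0 < critical_length \<beta> n \<and> critical_length \<beta> n < 1"
    by (auto simp: eventually_at_top_linorder)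
  \<comment> \<open>Constant up to \<open>N\<close>, so that the sequence is decreasing with values
    in the unit interval from the start.\<close>
  define l where "l n = critical_length \<beta> (max n N)" for n
  have "l (Suc n) \<le> l n" for n
    using N[of n] by (cases "N \<le> n") (auto simp: l_def max_def le_Suc_eq)
  then have "decseq l" by (rule decseq_SucI)
  then have "arc_lengths l"
    using N by (auto simp: arc_lengths_def l_def monotone_on_def decseq_def)
  moreover have "\<forall>\<^sub>F n in sequentially. l n = critical_length \<beta> n"
    using eventually_ge_at_top[of N] by eventually_elim (simp add: l_def)
  ultimately show ?thesis by blast
qed

text \<open>The partial sums are \<open>ln n - (1 + \<beta>) * ln (ln n)\<close> up to a bounded
  error: from \<open>N\<close> on both sums are compared with differences of antiderivatives, and
  \<open>C\<close> collects the initial sum and the boundary terms.\<close>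

lemma critical_sum_bounds:
  assumes \<beta>: "\<beta> > 0" and ev: "\<forall>\<^sub>F n in sequentially. l n = critical_length \<beta> n"
  obtains N C where "3 \<le> N" "\<And>n. n \<ge> N \<Longrightarrow> l n = critical_length \<beta> n"
    "\<And>n. n \<ge> N \<Longrightarrow> \<bar>(\<Sum>k=1..n. l k) - (ln (real n) - (1 + \<beta>) * ln (ln (real n)))\<bar> \<le> C"
proof -
  obtain N' where N': "\<And>n. n \<ge> N' \<Longrightarrow> l n = critical_length \<beta> n"
    using ev by (auto simp: eventually_at_top_linorder)
  \<comment> \<open>Starting at 3 keeps \<open>ln (N - 1)\<close> positive, as the upper bound for
    the second sum requires.\<close>
  define N where "N = max 3 N'"
  have N: "3 \<le> N" "\<And>n. n \<ge> N \<Longrightarrow> l n = critical_length \<beta> n" using N' by (auto simp: N_def)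
  define S0 where "S0 = (\<Sum>k\<in>{1..<N}. l k)"
  define C where "C = \<bar>S0\<bar> + \<bar>ln (real N - 1)\<bar> + \<bar>ln (real N)\<bar>
    + \<bar>(1 + \<beta>) * ln (ln (real N))\<bar> + \<bar>(1 + \<beta>) * ln (ln (real N - 1))\<bar>"
  have bound: "\<bar>(\<Sum>k=1..n. l k) - (ln (real n) - (1 + \<beta>) * ln (ln (real n)))\<bar> \<le> C" if n: "n \<ge> N" for n
  proof -
    define H where "H = (\<Sum>k\<in>{N..n}. 1 / real k)"
    define G where "G = (\<Sum>k\<in>{N..n}. 1 / (real k * ln (real k)))"
    have "{1..n} = {1..<N} \<union> {N..n}" using N n by auto
    then have "(\<Sum>k=1..n. l k) = S0 + (\<Sum>k\<in>{N..n}. l k)"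
      unfolding S0_def by (simp only:) (rule sum.union_disjoint, auto)
    also have "(\<Sum>k\<in>{N..n}. l k) = (\<Sum>k\<in>{N..n}. 1 / real k - (1 + \<beta>) * (1 / (real k * ln (real k))))"
      by (intro sum.cong refl) (simp add: N critical_length_def)
    also have "\<dots> = H - (1 + \<beta>) * G"
      by (simp only: H_def G_def sum_subtractf sum_distrib_left)
    finally have S: "(\<Sum>k=1..n. l k) = S0 + (H - (1 + \<beta>) * G)" .
    have "H \<le> ln (real n) - ln (real N - 1)"
      unfolding H_def using N n by (intro sum_inverse_le_ln) auto
    moreover have "ln (real n) - ln (real N) \<le> H"
    proof -
      have "ln (real n) - ln (real N) \<le> ln ((real n + 1) / real N)"
        using N n by (simp add: ln_div)
      also have "\<dots> \<le> H" unfolding H_def using N n by (intro ln_le_sum_inverse) auto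
      finally show ?thesis .
    qed
    moreover have "(1 + \<beta>) * (ln (ln (real n)) - ln (ln (real N))) \<le> (1 + \<beta>) * G"
    proof (rule mult_left_mono)
      have "ln (ln (real n)) \<le> ln (ln (real (Suc n)))" using N n by simp
      then show "ln (ln (real n)) - ln (ln (real N)) \<le> G"
        using sum_inverse_ln_ge[of N n] N n unfolding G_def by linarith
    qed (use \<beta> in auto)
    moreover have "(1 + \<beta>) * G \<le> (1 + \<beta>) * (ln (ln (real n)) - ln (ln (real N - 1)))"
      unfolding G_def using N n \<beta> by (intro mult_left_mono sum_inverse_ln_le) auto
    ultimately show ?thesis unfolding S C_def right_diff_distrib by linarith
  qed
  show thesis by (rule that[OF N bound])
qed

text \<open>Both the iterated logarithm and the bounded error are negligible against
  \<open>ln n\<close>, so the quotient is eventually at least a sequence with limit 1.\<close>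

lemma critical_limsup:
  assumes \<beta>: "\<beta> > 0" and ev: "\<forall>\<^sub>F n in sequentially. l n = critical_length \<beta> n"
  shows "1 \<le> limsup (\<lambda>n. ereal ((\<Sum>k=1..n. l k) / ln (real n)))"
proof -
  obtain N C where N: "3 \<le> N" "\<And>n. n \<ge> N \<Longrightarrow> l n = critical_length \<beta> n"
    "\<And>n. n \<ge> N \<Longrightarrow> \<bar>(\<Sum>k=1..n. l k) - (ln (real n) - (1 + \<beta>) * ln (ln (real n)))\<bar> \<le> C"
    by (rule critical_sum_bounds[OF \<beta> ev], rule that)
  define h where "h n = (ln (real n) - (1 + \<beta>) * ln (ln (real n)) - C) / ln (real n)" for n
  have "h \<longlonglongrightarrow> 1" unfolding h_def by real_asymp
  then have "limsup (\<lambda>n. ereal (h n)) = 1"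
    by (intro lim_imp_Limsup) (auto simp: one_ereal_def)
  moreover have "limsup (\<lambda>n. ereal (h n)) \<le> limsup (\<lambda>n. ereal ((\<Sum>k=1..n. l k) / ln (real n)))"
  proof (rule Limsup_mono)
    show "\<forall>\<^sub>F n in sequentially. ereal (h n) \<le> ereal ((\<Sum>k=1..n. l k) / ln (real n))"
      using eventually_ge_at_top[of N]
    proof eventually_elim
      case (elim n)
      then have "ln (real n) - (1 + \<beta>) * ln (ln (real n)) - C \<le> (\<Sum>k=1..n. l k)"
        using N(3)[of n] unfolding abs_le_iff by linarith
      moreover have "0 \<le> ln (real n)" using elim N(1) by simp
      ultimately show ?case unfolding h_def by (simp add: divide_right_mono)
    qed
  qed
  ultimately show ?thesis by simp
qed

lemma critical_not_covered:
  assumes \<beta>: "\<beta> \<ge> 1" and l: "arc_lengths l" and ev: "\<forall>\<^sub>F n in sequentially. l n = critical_length \<beta> n"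
  shows "\<not> dvoretzky_covered (\<lambda>_. 1) l"
proof -
  have \<beta>0: "\<beta> > 0" using \<beta> by simp
  obtain N C where N: "3 \<le> N" "\<And>n. n \<ge> N \<Longrightarrow> l n = critical_length \<beta> n"
    "\<And>n. n \<ge> N \<Longrightarrow> \<bar>(\<Sum>k=1..n. l k) - (ln (real n) - (1 + \<beta>) * ln (ln (real n)))\<bar> \<le> C"
    by (rule critical_sum_bounds[OF \<beta>0 ev], rule that)
  \<comment> \<open>\<open>N \<ge> 3\<close> exceeds Euler's number, so \<open>ln (ln n)\<close> is
    nonnegative from \<open>N\<close> on.\<close>
  have ln_ge: "1 \<le> ln (real n)" if "n \<ge> N" for n
    using exp_le that N(1) by (subst ln_ge_iff) auto
  have B: "l n \<le> real N / real n" if n: "n \<ge> 1" for n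
  proof (cases "n \<ge> N")
    case True
    have "0 \<le> (1 + \<beta>) / (real n * ln (real n))" using ln_ge[OF True] \<beta> by simp
    then have "l n \<le> 1 / real n" using True by (simp add: N critical_length_def)
    also have "\<dots> \<le> real N / real n" using N(1) by (intro divide_right_mono) auto
    finally show ?thesis .
  next
    case False
    have "l n \<le> 1" using l n by (simp add: arc_lengths_def less_imp_le)
    also have "1 \<le> real N / real n" using False n by simp
    finally show ?thesis .
  qed
  have l0: "l \<longlonglongrightarrow> 0"
  proof (rule tendsto_sandwich)
    show "\<forall>\<^sub>F n in sequentially. 0 \<le> l n"
      using eventually_ge_at_top[of 1] by eventually_elim (use l in \<open>simp add: arc_lengths_def less_imp_le\<close>)
    show "\<forall>\<^sub>F n in sequentially. l n \<le> real N / real n"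
      using eventually_ge_at_top[of 1] by eventually_elim (rule B)
    show "(\<lambda>n. real N / real n) \<longlonglongrightarrow> 0" by (rule lim_const_over_n)
  qed auto
  show ?thesis
  proof (rule not_covered_if_summable[OF prob_density_const_1 l l0 B, of 1 UNIV 1])
    fix n :: nat and x :: circle assume "1 \<le> n"
    then have "0 \<le> l n / 2" using l by (simp add: arc_lengths_def less_imp_le)
    then show "measure (density_measure (\<lambda>_. 1)) (ball x (l n / 2)) \<le> 1 * l n"
      using measure_density_const_1_ball_le[of "l n / 2" x] by simp
  next
    have "\<forall>\<^sub>F n in sequentially. norm (exp (1 * (\<Sum>k=1..n. l k)) / (real n)\<^sup>2)
        \<le> exp C * (1 / (real n * (ln (real n))\<^sup>2))"
      using eventually_ge_at_top[of N]
    proof eventually_elim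
      case (elim n)
      have n: "0 < real n" using elim N(1) by simp
      have L: "1 \<le> ln (real n)" using ln_ge[OF elim] .
      \<comment> \<open>Reducing the coefficient \<open>1 + \<beta>\<close> to 2 still leaves the
        summable majorant \<open>1 / (n * (ln n)\<^sup>2)\<close>.\<close>
      have "2 * ln (ln (real n)) \<le> (1 + \<beta>) * ln (ln (real n))"
        using L \<beta> by (intro mult_right_mono) auto
      then have "(\<Sum>k=1..n. l k) \<le> C + ln (real n) - 2 * ln (ln (real n))"
        using N(3)[OF elim] unfolding abs_le_iff by linarith
      then have le: "exp (\<Sum>k=1..n. l k) \<le> exp (C + ln (real n) - 2 * ln (ln (real n)))" by simp
      have "exp (2 * ln (ln (real n))) = (ln (real n))\<^sup>2"
      proof -
        have "0 < ln (real n)" using L by linarith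
        then have "exp (ln (ln (real n))) = ln (real n)" by (rule exp_ln)
        then show ?thesis using exp_of_nat_mult[of 2 "ln (ln (real n))"] by (simp only: of_nat_numeral)
      qed
      then have "exp (C + ln (real n) - 2 * ln (ln (real n))) = exp C * real n / (ln (real n))\<^sup>2"
        using n by (simp only: exp_diff exp_add exp_ln)
      with le have "exp (\<Sum>k=1..n. l k) \<le> exp C * real n / (ln (real n))\<^sup>2" by (simp only:)
      then have "exp (\<Sum>k=1..n. l k) / (real n)\<^sup>2 \<le> (exp C * real n / (ln (real n))\<^sup>2) / (real n)\<^sup>2"
        by (rule divide_right_mono) simp
      also have "\<dots> = exp C * (1 / (real n * (ln (real n))\<^sup>2))"
        using n by (simp add: power2_eq_square)
      finally show ?case by simp
    qed
    then show "summable (\<lambda>n. exp (1 * (\<Sum>k=1..n. l k)) / (real n)\<^sup>2)"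
      by (rule summable_comparison_test_ev) (intro summable_mult summable_inverse_ln_square)
  qed (auto simp: circle_lebesgue_UNIV_pos)
qed

section \<open>Covering criterion and its failure in full dimension\<close>

theorem theorem6p2:
  shows
    "(\<forall>(f :: circle \<Rightarrow> real) (l :: nat \<Rightarrow> real).
        prob_density f \<and> arc_lengths l \<and> ess_min f > 0 \<and> hausdorff_dim (ess_min_set f) < 1 \<and>
        hausdorff_dim (ess_min_set f) < liminf (\<lambda>n. ereal (ess_min f * real n * l n)) \<and>
        limsup (\<lambda>n. ereal (ess_min f * real n * l n)) < \<infinity>
        \<longrightarrow> (dvoretzky_covered f l \<longleftrightarrow>
              limsup (\<lambda>n. ereal ((\<Sum>k=1..n. l k) / ln (real n))) \<ge> ereal (1 / ess_min f)))
     \<and>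
     (\<forall>\<beta>::real. \<beta> > 1 \<longrightarrow>
        (\<exists>f :: circle \<Rightarrow> real.
          prob_density f \<and> ess_min f > 0 \<and> hausdorff_dim (ess_min_set f) = 1 \<and>
          (let eventual_form = (\<lambda>l :: nat \<Rightarrow> real. \<forall>\<^sub>F n in sequentially.
                 l n = 1 / ess_min f * (1 / real n - (1 + \<beta>) / (real n * ln (real n))))
           in (\<exists>l. arc_lengths l \<and> eventual_form l) \<and>
              (\<forall>l. arc_lengths l \<and> eventual_form l \<longrightarrow>
                 limsup (\<lambda>n. ereal ((\<Sum>k=1..n. l k) / ln (real n))) \<ge> ereal (1 / ess_min f) \<and>
                 \<not> dvoretzky_covered f l))))"
  (is "?P1 \<and> ?P2")
proof
  show ?P1
    using dvoretzky_covered_if dvoretzky_covered_only_if by blast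
  show ?P2
  proof (intro allI impI)
    fix \<beta> :: real assume \<beta>: "\<beta> > 1"
    have form: "(1 / ess_min (\<lambda>_. 1) * (1 / real n - (1 + \<beta>) / (real n * ln (real n)))) = critical_length \<beta> n" for n
      by (simp add: critical_length_def ess_min_const)
    have lim: "ereal (1 / ess_min (\<lambda>_. 1)) \<le> limsup (\<lambda>n. ereal ((\<Sum>k=1..n. l k) / ln (real n)))"
      if "\<forall>\<^sub>F n in sequentially. l n = critical_length \<beta> n" for l
      using critical_limsup[OF _ that] \<beta> by (simp add: ess_min_const one_ereal_def)
    show "\<exists>f :: circle \<Rightarrow> real.
          prob_density f \<and> ess_min f > 0 \<and> hausdorff_dim (ess_min_set f) = 1 \<and>
          (let eventual_form = (\<lambda>l :: nat \<Rightarrow> real. \<forall>\<^sub>F n in sequentially.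
                 l n = 1 / ess_min f * (1 / real n - (1 + \<beta>) / (real n * ln (real n))))
           in (\<exists>l. arc_lengths l \<and> eventual_form l) \<and>
              (\<forall>l. arc_lengths l \<and> eventual_form l \<longrightarrow>
                 limsup (\<lambda>n. ereal ((\<Sum>k=1..n. l k) / ln (real n))) \<ge> ereal (1 / ess_min f) \<and>
                 \<not> dvoretzky_covered f l))"
    proof (intro exI[of _ "\<lambda>_. 1"] conjI)
      show "ess_min (\<lambda>_. 1) > 0" by (simp add: ess_min_const)
      show "hausdorff_dim (ess_min_set (\<lambda>_. 1)) = 1"
        by (simp add: ess_min_set_const hausdorff_dim_circle)
    qed (unfold Let_def form, use exists_arc_lengths_critical critical_not_covered[OF less_imp_le[OF \<beta>]] lim in
        \<open>auto simp: prob_density_const_1\<close>)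
  qed
qed

end
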